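(* Let $M$ be a simple smooth $\mathcal{S}(\frac12)$-module of level $\lambda\in\mathbb{C}^*$. Then $M\cong\mathscr{V}(\frac12)^{\sqrt\lambda}\otimes V^{\mathcal{S}(\frac12)}$ for some simple smooth $\mathrm{Vir}$-module $V$ and some $\sqrt\lambda\in\mathbb{C}$ with $(\sqrt\lambda)^2=\lambda$, where $\mathscr{V}(\frac12)^{\sqrt\lambda}$ is considered as an $\mathcal{S}(\frac12)$-module.
   Context: All vector spaces and algebras are over $\mathbb{C}$; $\mathbb{Z}_+$ is the set of non-negative integers, $\mathbb{C}^*$ the nonzero complex numbers. Modules over Lie superalgebras are $\mathbb{Z}_2$-graded, and simple means having no nonzero proper graded submodule. The Virasoro algebra is regarded as a purely even Lie superalgebra, so a simple $\mathrm{Vir}$-module is concentrated in a single parity, which may be even or odd. The Fermion-Virasoro algebra $\mathcal{S}(\frac12)$ is the Lie superalgebra with basis $\{L_m,\psi_n,c,z:m\in\mathbb{Z},n\in\mathbb{Z}+\frac12\}$, where $L_m,c,z$ are even and $\psi_n$ odd, with $$[L_m,L_n]=(m-n)L_{m+n}+\delta_{m,-n}\tfrac{m^3-m}{12}c,\quad [L_m,\psi_n]=(-n-\tfrac m2)\psi_{m+n},\quad [\psi_m,\psi_n]=\delta_{m,-n}z,$$ and $c,z$ central. It contains $\mathrm{Vir}=\mathrm{span}\{c,L_i:i\in\mathbb{Z}\}$ and $F(\frac12)=\mathrm{span}\{z,\psi_i:i\in\mathbb{Z}+\frac12\}$. A module has level $\ell$ if $z$ acts as the scalar $\ell$. An $\mathcal{S}(\frac12)$-module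 $M$ is smooth if for every $v\in M$ there is $n\in\mathbb{Z}_+$ with $L_iv=0$ and $\psi_jv=0$ for all $i\in\mathbb{Z}$, $j\in\mathbb{Z}+\frac12$ with $i,j>n$; a $\mathrm{Vir}$-module is smooth if for every $v$ there is $n$ with $L_iv=0$ for all $i>n$. $\mathscr{V}(\frac12)$ is the exterior algebra generated by odd elements $\xi_i$, $i\in\mathbb{Z}_++\frac12$. It is an $F(\frac12)$-module: for $n\in\mathbb{Z}_++\frac12$, $\psi_n$ acts as the odd derivation $\partial/\partial\xi_n$, $\psi_{-n}$ as left multiplication by $\xi_n$, $z$ as the identity. It is an $\mathcal{S}(\frac12)$-module with $c$ acting as $\frac12$ and $L_k$ acting as $$\bar L_k=\tfrac12\sum_{j\in\mathbb{Z}+\frac12}j:\psi_{-j}\psi_{j+k}:,$$ where $:\psi_j\psi_k:\,=\psi_j\psi_k$ if $k\ge j$ and $-\psi_k\psi_j$ if $k<j$ (Kac–Raina–Rozhkovskaya). For $\mu\in\mathbb{C}^*$, $\sigma_\mu$ is the automorphism of $\mathcal{S}(\frac12)$ with $\sigma_\mu(L_k)=L_k$, $\sigma_\mu(\psi_l)=\mu\psi_l$, $\sigma_\mu(c)=c$, $\sigma_\mu(z)=\mu^2z$, and for an $\mathcal{S}(\frac12)$-module $W$, $W^\mu$ is the same space with action $x\cdot v=\sigma_\mu(x)v$. For a $\mathrm{Vir}$-module $V$, $V^{\mathcal{S}(\frac12)}$ denotes $V$ made into an $\mathcal{S}(\frac12)$-module by $F(\frac12)\cdot V=0$. Tensor products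 are the usual tensor products of modules over a Lie superalgebra. *)

theory Defs
  imports Complex_Main "HOL-Library.Poly_Mapping" "HOL-Library.FSet" "HOL-Library.Z2"
begin

section \<open>Complex vector spaces\<close>

class complex_vector = ab_group_add +
  fixes scaleC :: "complex \<Rightarrow> 'a \<Rightarrow> 'a"  (infixr "*\<^sub>C" 75)
  assumes scaleC_add_right: "a *\<^sub>C (x + y) = a *\<^sub>C x + a *\<^sub>C y"
    and scaleC_add_left: "(a + b) *\<^sub>C x = a *\<^sub>C x + b *\<^sub>C x"
    and scaleC_scaleC: "a *\<^sub>C (b *\<^sub>C x) = (a * b) *\<^sub>C x"
    and scaleC_one: "1 *\<^sub>C x = x"

global_interpretation complex_vector: vector_space "scaleC :: complex \<Rightarrow> 'a \<Rightarrow> 'a::complex_vector"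
  by unfold_locales (simp_all add: scaleC_add_right scaleC_add_left scaleC_scaleC scaleC_one)

abbreviation cspan :: "'a::complex_vector set \<Rightarrow> 'a set"
  where "cspan \<equiv> complex_vector.span"

abbreviation csubspace :: "'a::complex_vector set \<Rightarrow> bool"
  where "csubspace \<equiv> complex_vector.subspace"

abbreviation clinear :: "('a::complex_vector \<Rightarrow> 'b::complex_vector) \<Rightarrow> bool"
  where "clinear \<equiv> Vector_Spaces.linear scaleC scaleC"

definition clinear_on :: "'a::complex_vector set \<Rightarrow> ('a \<Rightarrow> 'b::complex_vector) \<Rightarrow> bool" where
  "clinear_on A f \<longleftrightarrow>
     (\<forall>x\<in>A. \<forall>y\<in>A. f (x + y) = f x + f y) \<and> (\<forall>a. \<forall>x\<in>A. f (a *\<^sub>C x) = a *\<^sub>C f x)"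

instantiation complex :: complex_vector
begin

definition scaleC_complex :: "complex \<Rightarrow> complex \<Rightarrow> complex" where
  "scaleC_complex a x = a * x"

instance
  by standard (simp_all add: scaleC_complex_def algebra_simps)

end

instantiation poly_mapping :: (type, complex_vector) complex_vector
begin

definition scaleC_poly_mapping :: "complex \<Rightarrow> ('a \<Rightarrow>\<^sub>0 'b) \<Rightarrow> 'a \<Rightarrow>\<^sub>0 'b" where
  "scaleC_poly_mapping a = Poly_Mapping.map (scaleC a)"

lemma lookup_scaleC: "Poly_Mapping.lookup (a *\<^sub>C p) k = a *\<^sub>C Poly_Mapping.lookup p k"
  by (simp add: scaleC_poly_mapping_def Poly_Mapping.map.rep_eq when_def)

instance
  by standard
    (rule poly_mapping_eqI; simp add: lookup_scaleC lookup_add complex_vector.scale_right_distrib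
      complex_vector.scale_left_distrib)+

end

text \<open>The free vector space on a set \<open>'b\<close> of basis symbols is \<open>'b \<Rightarrow>\<^sub>0 complex\<close>.\<close>

abbreviation basis_vec :: "'b \<Rightarrow> 'b \<Rightarrow>\<^sub>0 complex"
  where "basis_vec b \<equiv> Poly_Mapping.single b 1"

definition lin_ext :: "('b \<Rightarrow> 'v::complex_vector) \<Rightarrow> ('b \<Rightarrow>\<^sub>0 complex) \<Rightarrow> 'v" where
  "lin_ext f x = (\<Sum>b\<in>Poly_Mapping.keys x. Poly_Mapping.lookup x b *\<^sub>C f b)"

lemma lin_ext_superset:
  assumes "finite A" "Poly_Mapping.keys x \<subseteq> A"
  shows "lin_ext f x = (\<Sum>b\<in>A. Poly_Mapping.lookup x b *\<^sub>C f b)"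
  unfolding lin_ext_def
  by (rule sum.mono_neutral_left) (use assms in \<open>auto simp: in_keys_iff\<close>)

lemma lin_ext_add: "lin_ext f (x + y) = lin_ext f x + lin_ext f y"
proof -
  let ?A = "Poly_Mapping.keys x \<union> Poly_Mapping.keys y"
  show ?thesis
    using lin_ext_superset[of ?A x f] lin_ext_superset[of ?A y f] lin_ext_superset[of ?A "x + y" f]
    by (simp add: Poly_Mapping.keys_add lookup_add complex_vector.scale_left_distrib sum.distrib)
qed

lemma lin_ext_scaleC: "lin_ext f (a *\<^sub>C x) = a *\<^sub>C lin_ext f x"
proof -
  have "lin_ext f (a *\<^sub>C x) = (\<Sum>b\<in>Poly_Mapping.keys x. Poly_Mapping.lookup (a *\<^sub>C x) b *\<^sub>C f b)"
    by (rule lin_ext_superset) (auto simp: in_keys_iff lookup_scaleC)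
  then show ?thesis
    by (simp add: lookup_scaleC scaleC_complex_def lin_ext_def complex_vector.scale_sum_right)
qed

lemma lin_ext_basis [simp]: "lin_ext f (basis_vec b) = f b"
  by (simp add: lin_ext_def)

lemma lin_ext_0 [simp]: "lin_ext f 0 = 0"
  by (simp add: lin_ext_def)

lemma lin_ext_uminus: "lin_ext f (- x) = - lin_ext f x"
  using lin_ext_add[of f x "- x"] by (simp add: eq_neg_iff_add_eq_0 add.commute)

lemma lin_ext_fun_add: "lin_ext (\<lambda>b. f b + g b) x = lin_ext f x + lin_ext g x"
  by (simp add: lin_ext_def complex_vector.scale_right_distrib sum.distrib)

lemma lin_ext_fun_scaleC: "lin_ext (\<lambda>b. a *\<^sub>C f b) x = a *\<^sub>C lin_ext f x"
  by (simp add: lin_ext_def complex_vector.scale_sum_right mult.commute)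


section \<open>Tensor product of vector spaces\<close>

definition tensor_null :: "(('a::complex_vector \<times> 'b::complex_vector) \<Rightarrow>\<^sub>0 complex) set" where
  "tensor_null = cspan
     ({basis_vec (u + u', v) - basis_vec (u, v) - basis_vec (u', v) | u u' v. True} \<union>
      {basis_vec (u, v + v') - basis_vec (u, v) - basis_vec (u, v') | u v v'. True} \<union>
      {basis_vec (a *\<^sub>C u, v) - a *\<^sub>C basis_vec (u, v) | a u v. True} \<union>
      {basis_vec (u, a *\<^sub>C v) - a *\<^sub>C basis_vec (u, v) | a u v. True})"

lemma csubspace_tensor_null: "csubspace tensor_null"
  unfolding tensor_null_def by (rule complex_vector.subspace_span)

definition tensor_rel ::
    "(('a::complex_vector \<times> 'b::complex_vector) \<Rightarrow>\<^sub>0 complex) \<Rightarrow> (('a \<times> 'b) \<Rightarrow>\<^sub>0 complex) \<Rightarrow> bool" where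
  "tensor_rel p q \<longleftrightarrow> p - q \<in> tensor_null"

lemma tensor_rel_refl [simp]: "tensor_rel p p"
  by (simp add: tensor_rel_def complex_vector.subspace_0[OF csubspace_tensor_null])

lemma tensor_rel_add: "tensor_rel p p' \<Longrightarrow> tensor_rel q q' \<Longrightarrow> tensor_rel (p + q) (p' + q')"
  unfolding tensor_rel_def add_diff_add by (rule complex_vector.subspace_add[OF csubspace_tensor_null])

lemma tensor_rel_scaleC: "tensor_rel p p' \<Longrightarrow> tensor_rel (a *\<^sub>C p) (a *\<^sub>C p')"
  unfolding tensor_rel_def complex_vector.scale_right_diff_distrib[symmetric]
  by (rule complex_vector.subspace_scale[OF csubspace_tensor_null])

lemma tensor_rel_uminus: "tensor_rel p p' \<Longrightarrow> tensor_rel (- p) (- p')"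
  using tensor_rel_scaleC[of p p' "- 1"] by simp

lemma tensor_rel_diff: "tensor_rel p p' \<Longrightarrow> tensor_rel q q' \<Longrightarrow> tensor_rel (p - q) (p' - q')"
  using tensor_rel_add[of p p' "- q" "- q'"] tensor_rel_uminus[of q q'] by simp

lemma equivp_tensor_rel: "equivp tensor_rel"
proof (intro equivpI reflpI sympI transpI)
  show "tensor_rel q p" if "tensor_rel p q" for p q :: "('a \<times> 'b) \<Rightarrow>\<^sub>0 complex"
    using complex_vector.subspace_neg[OF csubspace_tensor_null, of "p - q"] that
    by (simp add: tensor_rel_def)
  show "tensor_rel p r" if "tensor_rel p q" "tensor_rel q r" for p q r :: "('a \<times> 'b) \<Rightarrow>\<^sub>0 complex"
    using complex_vector.subspace_add[OF csubspace_tensor_null, of "p - q" "q - r"] that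
    by (simp add: tensor_rel_def)
qed simp

quotient_type (overloaded) ('a, 'b) tensor =
  "('a::complex_vector \<times> 'b::complex_vector) \<Rightarrow>\<^sub>0 complex" / tensor_rel
  by (rule equivp_tensor_rel)

instantiation tensor :: (complex_vector, complex_vector) complex_vector
begin

lift_definition zero_tensor :: "('a, 'b) tensor" is 0 .

lift_definition plus_tensor :: "('a, 'b) tensor \<Rightarrow> ('a, 'b) tensor \<Rightarrow> ('a, 'b) tensor" is "(+)"
  by (rule tensor_rel_add)

lift_definition uminus_tensor :: "('a, 'b) tensor \<Rightarrow> ('a, 'b) tensor" is uminus
  by (rule tensor_rel_uminus)

lift_definition minus_tensor :: "('a, 'b) tensor \<Rightarrow> ('a, 'b) tensor \<Rightarrow> ('a, 'b) tensor" is "(-)"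
  by (rule tensor_rel_diff)

lift_definition scaleC_tensor :: "complex \<Rightarrow> ('a, 'b) tensor \<Rightarrow> ('a, 'b) tensor" is scaleC
  by (rule tensor_rel_scaleC)

instance
proof
  fix x y z :: "('a, 'b) tensor" and a b :: complex
  show "x + y + z = x + (y + z)" by transfer (simp add: add.assoc)
  show "x + y = y + x" by transfer (simp add: add.commute)
  show "0 + x = x" by transfer simp
  show "- x + x = 0" by transfer simp
  show "x - y = x + - y" by transfer simp
  show "a *\<^sub>C (x + y) = a *\<^sub>C x + a *\<^sub>C y"
    by transfer (simp add: complex_vector.scale_right_distrib)
  show "(a + b) *\<^sub>C x = a *\<^sub>C x + b *\<^sub>C x"
    by transfer (simp add: complex_vector.scale_left_distrib)
  show "a *\<^sub>C b *\<^sub>C x = (a * b) *\<^sub>C x" by transfer simp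
  show "1 *\<^sub>C x = x" by transfer simp
qed

end

lift_definition tensor_of :: "'a::complex_vector \<Rightarrow> 'b::complex_vector \<Rightarrow> ('a, 'b) tensor"
    (infixl "\<otimes>" 70)
  is "\<lambda>u v. basis_vec (u, v)" .


section \<open>Lie superalgebras and their modules\<close>

text \<open>A superspace is given by its two homogeneous parts, indexed by \<open>bit\<close> (the field with two
  elements), inside an ambient complex vector space; the superspace itself is their direct sum,
  the set \<open>whole P\<close> below, and need not be the whole type.\<close>

type_synonym 'a super = "bit \<Rightarrow> 'a set"

definition superspace :: "'a::complex_vector super \<Rightarrow> bool" where
  "superspace P \<longleftrightarrow> csubspace (P 0) \<and> csubspace (P 1) \<and> P 0 \<inter> P 1 = {0}"

definition whole :: "'a::complex_vector super \<Rightarrow> 'a set" where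
  "whole P = {x + y | x y. x \<in> P 0 \<and> y \<in> P 1}"

text \<open>The sign $(-1)^{ij}$.\<close>

definition koszul :: "bit \<Rightarrow> bit \<Rightarrow> complex" where
  "koszul i j = (if i = 1 \<and> j = 1 then - 1 else 1)"

record 'g superalgebra =
  gpart :: "'g super"
  bracket :: "'g \<Rightarrow> 'g \<Rightarrow> 'g"

definition lie_superalgebra :: "'g::complex_vector superalgebra \<Rightarrow> bool" where
  "lie_superalgebra g \<longleftrightarrow> superspace (gpart g) \<and>
     (\<forall>x\<in>whole (gpart g). clinear_on (whole (gpart g)) (bracket g x) \<and>
                          clinear_on (whole (gpart g)) (\<lambda>y. bracket g y x)) \<and>
     (\<forall>i j. \<forall>x\<in>gpart g i. \<forall>y\<in>gpart g j. bracket g x y \<in> gpart g (i + j)) \<and>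
     (\<forall>i j. \<forall>x\<in>gpart g i. \<forall>y\<in>gpart g j. bracket g x y = - koszul i j *\<^sub>C bracket g y x) \<and>
     (\<forall>i j. \<forall>x\<in>gpart g i. \<forall>y\<in>gpart g j. \<forall>w\<in>whole (gpart g).
        bracket g x (bracket g y w) =
          bracket g (bracket g x y) w + koszul i j *\<^sub>C bracket g y (bracket g x w))"

text \<open>Only the values of the action at elements of the algebra and vectors in \<open>mspace M\<close> matter.\<close>

record ('g, 'm) supermodule =
  part :: "'m super"
  act :: "'g \<Rightarrow> 'm \<Rightarrow> 'm"

abbreviation mspace :: "('g, 'm::complex_vector, 'z) supermodule_scheme \<Rightarrow> 'm set" where
  "mspace M \<equiv> whole (part M)"

definition is_module ::
    "'g::complex_vector superalgebra \<Rightarrow> ('g, 'm::complex_vector) supermodule \<Rightarrow> bool" where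
  "is_module g M \<longleftrightarrow> superspace (part M) \<and>
     (\<forall>x\<in>whole (gpart g). clinear_on (mspace M) (act M x)) \<and>
     (\<forall>v\<in>mspace M. clinear_on (whole (gpart g)) (\<lambda>x. act M x v)) \<and>
     (\<forall>i j. \<forall>x\<in>gpart g i. \<forall>v\<in>part M j. act M x v \<in> part M (i + j)) \<and>
     (\<forall>i j. \<forall>x\<in>gpart g i. \<forall>y\<in>gpart g j. \<forall>v\<in>mspace M.
        act M (bracket g x y) v = act M x (act M y v) - koszul i j *\<^sub>C act M y (act M x v))"

definition graded_submodule ::
    "'g::complex_vector superalgebra \<Rightarrow> ('g, 'm::complex_vector) supermodule \<Rightarrow> 'm super \<Rightarrow> bool" where
  "graded_submodule g M N \<longleftrightarrow>
     (\<forall>i. csubspace (N i) \<and> N i \<subseteq> part M i) \<and>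
     (\<forall>x\<in>whole (gpart g). \<forall>v\<in>whole N. act M x v \<in> whole N)"

definition simple_module ::
    "'g::complex_vector superalgebra \<Rightarrow> ('g, 'm::complex_vector) supermodule \<Rightarrow> bool" where
  "simple_module g M \<longleftrightarrow> is_module g M \<and> mspace M \<noteq> {0} \<and>
     (\<forall>N. graded_submodule g M N \<longrightarrow> whole N = {0} \<or> whole N = mspace M)"

text \<open>Isomorphisms are required to be even.\<close>

definition isomorphic ::
    "'g::complex_vector superalgebra \<Rightarrow> ('g, 'm::complex_vector) supermodule \<Rightarrow>
     ('g, 'n::complex_vector) supermodule \<Rightarrow> bool" where
  "isomorphic g M N \<longleftrightarrow> (\<exists>\<phi>. clinear_on (mspace M) \<phi> \<and> bij_betw \<phi> (mspace M) (mspace N) \<and>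
     (\<forall>i. \<phi> ` part M i \<subseteq> part N i) \<and>
     (\<forall>x\<in>whole (gpart g). \<forall>v\<in>mspace M. \<phi> (act M x v) = act N x (\<phi> v)))"

text \<open>The tensor product of two superspaces embeds into that of the ambient spaces (over a field,
  tensoring is exact) and is identified with its image, the span of the pure tensors there. The action
  $x(u \otimes v) = xu \otimes v + (-1)^{|x||u|} u \otimes xv$ determines a linear operator on
  this span; outside of it the value of \<open>tensor_act\<close> is irrelevant. In the definition,
  \<open>x0\<close> and \<open>x1\<close> are the even and the odd component of \<open>x\<close>.\<close>

definition tensor_part ::
    "'a::complex_vector super \<Rightarrow> 'b::complex_vector super \<Rightarrow> ('a, 'b) tensor super" where
  "tensor_part P Q k = cspan {u \<otimes> v | u v i j. u \<in> P i \<and> v \<in> Q j \<and> i + j = k}"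

definition tensor_act ::
    "'g::complex_vector superalgebra \<Rightarrow> ('g, 'a::complex_vector) supermodule \<Rightarrow>
     ('g, 'b::complex_vector) supermodule \<Rightarrow> 'g \<Rightarrow> ('a, 'b) tensor \<Rightarrow> ('a, 'b) tensor" where
  "tensor_act g U V x = (SOME T. clinear T \<and>
     (\<forall>x0\<in>gpart g 0. \<forall>x1\<in>gpart g 1. x = x0 + x1 \<longrightarrow>
       (\<forall>j. \<forall>u\<in>part U j. \<forall>v\<in>mspace V.
          T (u \<otimes> v) = act U x u \<otimes> v + u \<otimes> act V x0 v + koszul 1 j *\<^sub>C (u \<otimes> act V x1 v))))"

definition tensor_module ::
    "'g::complex_vector superalgebra \<Rightarrow> ('g, 'a::complex_vector) supermodule \<Rightarrow>
     ('g, 'b::complex_vector) supermodule \<Rightarrow> ('g, ('a, 'b) tensor) supermodule" where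
  "tensor_module g U V =
     \<lparr>part = tensor_part (part U) (part V), act = tensor_act g U V\<rparr>"


section \<open>The Fermion-Virasoro algebra\<close>

text \<open>Half-integers are encoded by integers: \<open>k\<close> stands for \<open>half k\<close>, i.e. $k + \frac12$.
  Thus \<open>gPsi k\<close> is $\psi_{k+1/2}$.\<close>

definition half :: "int \<Rightarrow> 'a::field_char_0" where
  "half k = of_int k + 1 / 2"

datatype fv_gen = gL int | gPsi int | gC | gZ

type_synonym fv = "fv_gen \<Rightarrow>\<^sub>0 complex"

abbreviation "L m \<equiv> basis_vec (gL m)"
abbreviation "\<psi> n \<equiv> basis_vec (gPsi n)"
abbreviation "\<c> \<equiv> basis_vec gC"
abbreviation "\<z> \<equiv> basis_vec gZ"

fun fv_parity :: "fv_gen \<Rightarrow> bit" where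
  "fv_parity (gPsi n) = 1"
| "fv_parity _ = 0"

fun fv_gen_bracket :: "fv_gen \<Rightarrow> fv_gen \<Rightarrow> fv" where
  "fv_gen_bracket (gL m) (gL n) =
     of_int (m - n) *\<^sub>C L (m + n) + (if m = - n then (of_int (m ^ 3 - m) / 12) *\<^sub>C \<c> else 0)"
| "fv_gen_bracket (gL m) (gPsi n) = (- half n - of_int m / 2) *\<^sub>C \<psi> (m + n)"
| "fv_gen_bracket (gPsi n) (gL m) = - ((- half n - of_int m / 2) *\<^sub>C \<psi> (m + n))"
| "fv_gen_bracket (gPsi m) (gPsi n) = (if half m = - (half n :: rat) then \<z> else 0)"
| "fv_gen_bracket _ _ = 0"

definition fv_bracket :: "fv \<Rightarrow> fv \<Rightarrow> fv" where
  "fv_bracket x y = lin_ext (\<lambda>a. lin_ext (fv_gen_bracket a) y) x"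

definition FV :: "fv superalgebra" where
  "FV = \<lparr>gpart = (\<lambda>i. cspan {basis_vec b | b. fv_parity b = i}), bracket = fv_bracket\<rparr>"

lemma fv_bracket_add: "fv_bracket (x + x') y = fv_bracket x y + fv_bracket x' y"
    "fv_bracket x (y + y') = fv_bracket x y + fv_bracket x y'"
  by (simp_all add: fv_bracket_def lin_ext_add lin_ext_fun_add)

lemma fv_bracket_scaleC: "fv_bracket (a *\<^sub>C x) y = a *\<^sub>C fv_bracket x y"
    "fv_bracket x (a *\<^sub>C y) = a *\<^sub>C fv_bracket x y"
  by (simp_all add: fv_bracket_def lin_ext_scaleC lin_ext_fun_scaleC)

lemma fv_bracket_0 [simp]: "fv_bracket 0 y = 0" "fv_bracket x 0 = 0"
  using fv_bracket_scaleC(1)[of 0 0 y] fv_bracket_scaleC(2)[of x 0 0] by simp_all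

lemma fv_bracket_uminus: "fv_bracket (- x) y = - fv_bracket x y" "fv_bracket x (- y) = - fv_bracket x y"
  using fv_bracket_scaleC(1)[of "- 1" x y] fv_bracket_scaleC(2)[of x "- 1" y] by simp_all

lemma fv_bracket_diff: "fv_bracket (x - x') y = fv_bracket x y - fv_bracket x' y"
    "fv_bracket x (y - y') = fv_bracket x y - fv_bracket x y'"
  using fv_bracket_add(1)[of x "- x'" y] fv_bracket_add(2)[of x y "- y'"] by (simp_all add: fv_bracket_uminus)

lemma fv_bracket_basis: "fv_bracket (basis_vec a) (basis_vec b) = fv_gen_bracket a b"
  by (simp add: fv_bracket_def)

abbreviation "fv_part i \<equiv> cspan {basis_vec b | b. fv_parity b = i}"

lemma fv_part_keys: "x \<in> fv_part i \<Longrightarrow> Poly_Mapping.keys x \<subseteq> {b. fv_parity b = i}"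
proof (induction rule: complex_vector.span_induct_alt)
  case base then show ?case by simp
next
  case (step c x y)
  have "Poly_Mapping.keys (c *\<^sub>C x + y) \<subseteq> Poly_Mapping.keys x \<union> Poly_Mapping.keys y"
    by (auto simp: in_keys_iff lookup_add lookup_scaleC)
  with step show ?case by auto
qed

lemma fv_expand: "lin_ext basis_vec x = (x :: 'b \<Rightarrow>\<^sub>0 complex)"
proof (rule poly_mapping_eqI)
  fix k
  have "Poly_Mapping.lookup (lin_ext basis_vec x) k
      = (\<Sum>b\<in>Poly_Mapping.keys x. if b = k then Poly_Mapping.lookup x b else 0)"
    unfolding lin_ext_def lookup_sum
    by (rule sum.cong) (simp_all add: lookup_scaleC lookup_single when_def scaleC_complex_def)
  also have "\<dots> = Poly_Mapping.lookup x k"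
    by (simp add: sum.delta in_keys_iff)
  finally show "Poly_Mapping.lookup (lin_ext basis_vec x) k = Poly_Mapping.lookup x k" .
qed

lemma fv_span: "(x :: 'b \<Rightarrow>\<^sub>0 complex) \<in> cspan (range basis_vec)"
proof -
  have "lin_ext basis_vec x \<in> cspan (range basis_vec)"
    unfolding lin_ext_def
    by (intro complex_vector.span_sum complex_vector.span_scale complex_vector.span_base rangeI)
  then show ?thesis by (simp only: fv_expand)
qed

lemma whole_fv: "whole fv_part = UNIV"
proof -
  have "b = basis_vec c \<Longrightarrow> b \<in> {basis_vec b | b. fv_parity b = 0} \<union> {basis_vec b | b. fv_parity b = 1}" for b c
    by (cases "fv_parity c") auto
  then have "range basis_vec \<subseteq> {basis_vec b | b. fv_parity b = 0} \<union> {basis_vec b | b. fv_parity b = 1}"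
    by blast
  then have "x \<in> cspan ({basis_vec b | b. fv_parity b = 0} \<union> {basis_vec b | b. fv_parity b = 1})" for x
    using fv_span complex_vector.span_mono by blast
  then show ?thesis
    unfolding whole_def complex_vector.span_Un by blast
qed

lemma fv_part_induct2:
  assumes "x \<in> fv_part i" "y \<in> fv_part j"
    and P: "\<And>a b. fv_parity a = i \<Longrightarrow> fv_parity b = j \<Longrightarrow> P (basis_vec a) (basis_vec b)"
    and "\<And>y. P 0 y" "\<And>x. P x 0"
    and "\<And>c x x' y. P x y \<Longrightarrow> P x' y \<Longrightarrow> P (c *\<^sub>C x + x') y"
    and "\<And>c x y y'. P x y \<Longrightarrow> P x y' \<Longrightarrow> P x (c *\<^sub>C y + y')"
  shows "P x y"
  using assms(1)
proof (induction rule: complex_vector.span_induct_alt)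
  case base then show ?case using assms by blast
next
  case (step c x x')
  then obtain a where a: "x = basis_vec a" "fv_parity a = i" by blast
  have "P x y" using assms(2)
  proof (induction rule: complex_vector.span_induct_alt)
    case base then show ?case using assms by blast
  next
    case (step c y y') then show ?case using assms(7) P a by blast
  qed
  then show ?case using step assms(6) by blast
qed

lemma half_eq: "half m = - (half n :: rat) \<longleftrightarrow> m + n = - 1"
proof -
  have "half m = - (half n :: rat) \<longleftrightarrow> of_int (m + n) = (of_int (- 1) :: rat)"
    by (auto simp: half_def algebra_simps eq_neg_iff_add_eq_0)
  then show ?thesis by (simp only: of_int_eq_iff)
qed


lemma fv_gen_skew: "fv_gen_bracket a b = - koszul (fv_parity a) (fv_parity b) *\<^sub>C fv_gen_bracket b a"
  by (cases a; cases b; rule poly_mapping_eqI)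
    (auto simp: koszul_def half_eq lookup_add lookup_scaleC lookup_minus lookup_single when_def scaleC_complex_def field_simps)


lemmas fv_bracket_simps = fv_bracket_add fv_bracket_diff fv_bracket_scaleC fv_bracket_uminus fv_bracket_basis

lemma fv_bracket_if: "fv_bracket (if P then x else x') y = (if P then fv_bracket x y else fv_bracket x' y)"
  "fv_bracket y (if P then x else x') = (if P then fv_bracket y x else fv_bracket y x')"
  by simp_all

definition jacobi_gen where "jacobi_gen a b w \<longleftrightarrow> fv_bracket (basis_vec a) (fv_gen_bracket b w) =
  fv_bracket (fv_gen_bracket a b) (basis_vec w) + koszul (fv_parity a) (fv_parity b) *\<^sub>C
  fv_bracket (basis_vec b) (fv_gen_bracket a w)"

lemmas lookup_simps = lookup_add lookup_scaleC lookup_single when_def scaleC_complex_def lookup_minus lookup_uminus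

lemma jacobi_gen_0: "jacobi_gen gC b w" "jacobi_gen gZ b w" "jacobi_gen a gC w" "jacobi_gen a gZ w" "jacobi_gen a b gC" "jacobi_gen a b gZ"
  unfolding jacobi_gen_def
  by (cases a; cases b; cases w; simp add: koszul_def fv_bracket_simps fv_bracket_if half_eq)+

lemma jacobi_gen_1: "jacobi_gen (gPsi a) (gPsi b) (gPsi w)"
  unfolding jacobi_gen_def by (simp add: koszul_def fv_bracket_simps fv_bracket_if half_eq)

lemma jacobi_gen_2: "jacobi_gen (gL a) (gPsi b) (gPsi w)"
proof (cases "a + b + w = - 1")
  case True
  then have w: "w = - 1 - a - b" by simp
  show ?thesis unfolding jacobi_gen_def w
    by (rule poly_mapping_eqI) (auto simp add: koszul_def fv_bracket_simps fv_bracket_if half_eq lookup_simps half_def field_simps)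
next
  case False
  then show ?thesis unfolding jacobi_gen_def
    by (auto simp add: koszul_def fv_bracket_simps fv_bracket_if half_eq algebra_simps)
qed
lemma jacobi_gen_3: "jacobi_gen (gPsi a) (gL b) (gPsi w)"
proof (cases "a + b + w = - 1")
  case True
  then have w: "w = - 1 - a - b" by simp
  show ?thesis unfolding jacobi_gen_def w
    by (rule poly_mapping_eqI) (auto simp add: koszul_def fv_bracket_simps fv_bracket_if half_eq lookup_simps half_def field_simps)
next
  case False
  then show ?thesis unfolding jacobi_gen_def
    by (auto simp add: koszul_def fv_bracket_simps fv_bracket_if half_eq algebra_simps)
qed
lemma jacobi_gen_4: "jacobi_gen (gPsi a) (gPsi b) (gL w)"
proof (cases "a + b + w = - 1")
  case True
  then have w: "w = - 1 - a - b" by simp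
  show ?thesis unfolding jacobi_gen_def w
    by (rule poly_mapping_eqI) (auto simp add: koszul_def fv_bracket_simps fv_bracket_if half_eq lookup_simps half_def field_simps)
next
  case False
  then show ?thesis unfolding jacobi_gen_def
    by (auto simp add: koszul_def fv_bracket_simps fv_bracket_if half_eq algebra_simps)
qed
lemma jacobi_gen_5: "jacobi_gen (gL a) (gL b) (gPsi w)"
  unfolding jacobi_gen_def
    by (rule poly_mapping_eqI) (auto simp add: koszul_def fv_bracket_simps fv_bracket_if half_eq lookup_simps half_def field_simps)
lemma jacobi_gen_6: "jacobi_gen (gL a) (gPsi b) (gL w)"
  unfolding jacobi_gen_def
    by (rule poly_mapping_eqI) (auto simp add: koszul_def fv_bracket_simps fv_bracket_if half_eq lookup_simps half_def field_simps)
lemma jacobi_gen_7: "jacobi_gen (gPsi a) (gL b) (gL w)"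
  unfolding jacobi_gen_def
    by (rule poly_mapping_eqI) (auto simp add: koszul_def fv_bracket_simps fv_bracket_if half_eq lookup_simps half_def field_simps)
lemma jacobi_gen_8: "jacobi_gen (gL a) (gL b) (gL w)"
proof (cases "a + b + w = 0")
  case True
  then have w: "w = - a - b" by simp
  show ?thesis unfolding jacobi_gen_def w
    by (rule poly_mapping_eqI) (auto simp add: koszul_def fv_bracket_simps fv_bracket_if lookup_simps field_simps power3_eq_cube)
next
  case False
  then show ?thesis unfolding jacobi_gen_def
    by (intro poly_mapping_eqI) (auto simp add: koszul_def fv_bracket_simps fv_bracket_if lookup_simps field_simps)
qed
lemma gen_jacobi: "jacobi_gen a b w"
  by (cases a; cases b; cases w; simp only: jacobi_gen_0 jacobi_gen_1 jacobi_gen_2 jacobi_gen_3 jacobi_gen_4 jacobi_gen_5 jacobi_gen_6 jacobi_gen_7 jacobi_gen_8)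

lemma fv_part_basis: "fv_parity b = i \<Longrightarrow> basis_vec b \<in> fv_part i"
  by (rule complex_vector.span_base) blast

lemma fv_gen_bracket_part: "fv_gen_bracket a b \<in> fv_part (fv_parity a + fv_parity b)"
  by (cases a; cases b)
    (auto intro!: complex_vector.span_add complex_vector.span_diff complex_vector.span_scale
      complex_vector.span_neg complex_vector.span_zero fv_part_basis)

lemma fv_bracket_part:
  assumes "x \<in> fv_part i" "y \<in> fv_part j"
  shows "fv_bracket x y \<in> fv_part (i + j)"
  using assms
proof (rule fv_part_induct2[where P = "\<lambda>x y. fv_bracket x y \<in> fv_part (i + j)"])
  fix a b assume "fv_parity a = i" "fv_parity b = j"
  then show "fv_bracket (basis_vec a) (basis_vec b) \<in> fv_part (i + j)"
    using fv_gen_bracket_part[of a b] by (simp add: fv_bracket_basis)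
qed (simp_all add: fv_bracket_simps complex_vector.span_zero complex_vector.span_add complex_vector.span_scale)

lemma fv_skew:
  assumes "x \<in> fv_part i" "y \<in> fv_part j"
  shows "fv_bracket x y = - koszul i j *\<^sub>C fv_bracket y x"
  using assms
proof (rule fv_part_induct2[where P = "\<lambda>x y. fv_bracket x y = - koszul i j *\<^sub>C fv_bracket y x"])
  fix a b assume "fv_parity a = i" "fv_parity b = j"
  then show "fv_bracket (basis_vec a) (basis_vec b) = - koszul i j *\<^sub>C fv_bracket (basis_vec b) (basis_vec a)"
    using fv_gen_skew[of a b] by (simp add: fv_bracket_basis)
qed (simp_all add: fv_bracket_simps complex_vector.scale_right_distrib complex_vector.scale_right_diff_distrib mult.commute)

lemma fv_jacobi:
  assumes "x \<in> fv_part i" "y \<in> fv_part j"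
  shows "fv_bracket x (fv_bracket y w) =
    fv_bracket (fv_bracket x y) w + koszul i j *\<^sub>C fv_bracket y (fv_bracket x w)"
  using assms
proof (rule fv_part_induct2[where P = "\<lambda>x y. fv_bracket x (fv_bracket y w) =
    fv_bracket (fv_bracket x y) w + koszul i j *\<^sub>C fv_bracket y (fv_bracket x w)"])
  fix a b assume ab: "fv_parity a = i" "fv_parity b = j"
  have "w \<in> cspan (range basis_vec)" by (rule fv_span)
  then show "fv_bracket (basis_vec a) (fv_bracket (basis_vec b) w) =
    fv_bracket (fv_bracket (basis_vec a) (basis_vec b)) w
     + koszul i j *\<^sub>C fv_bracket (basis_vec b) (fv_bracket (basis_vec a) w)"
  proof (induction rule: complex_vector.span_induct_alt)
    case (step c x y)
    then obtain d where "x = basis_vec d" by blast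
    with step gen_jacobi[of a b d] ab show ?case
      by (simp add: fv_bracket_simps jacobi_gen_def algebra_simps complex_vector.scale_right_distrib)
  qed simp
qed (simp_all add: fv_bracket_simps algebra_simps complex_vector.scale_right_distrib)

lemma superspace_fv: "superspace fv_part"
proof -
  have "x = 0" if "x \<in> fv_part 0" "x \<in> fv_part 1" for x
  proof -
    have "Poly_Mapping.keys x = {}"
      using fv_part_keys[OF that(1)] fv_part_keys[OF that(2)] by fastforce
    then show ?thesis by simp
  qed
  then have "fv_part 0 \<inter> fv_part 1 = {0}"
    using complex_vector.span_zero by blast
  then show ?thesis
    by (simp add: superspace_def complex_vector.subspace_span)
qed

lemma lie_superalgebra_FV: "lie_superalgebra FV"
proof -
  have "\<forall>i j. \<forall>x\<in>fv_part i. \<forall>y\<in>fv_part j. fv_bracket x y = - koszul i j *\<^sub>C fv_bracket y x"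
    using fv_skew by blast
  moreover have "\<forall>i j. \<forall>x\<in>fv_part i. \<forall>y\<in>fv_part j. fv_bracket x y \<in> fv_part (i + j)"
    using fv_bracket_part by blast
  moreover have "\<forall>i j. \<forall>x\<in>fv_part i. \<forall>y\<in>fv_part j. \<forall>w\<in>UNIV. fv_bracket x (fv_bracket y w) =
     fv_bracket (fv_bracket x y) w + koszul i j *\<^sub>C fv_bracket y (fv_bracket x w)"
    using fv_jacobi by blast
  moreover have "\<forall>x\<in>UNIV. clinear_on UNIV (fv_bracket x) \<and> clinear_on UNIV (\<lambda>y. fv_bracket y x)"
    by (simp add: clinear_on_def fv_bracket_simps)
  ultimately show ?thesis
    using superspace_fv unfolding lie_superalgebra_def FV_def superalgebra.simps whole_fv by blast
qed

text \<open>The Virasoro algebra, as a purely even subalgebra.\<close>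

definition Vir :: "fv superalgebra" where
  "Vir = \<lparr>gpart = (\<lambda>i. if i = 0 then cspan ({\<c>} \<union> range (\<lambda>m. L m)) else {0}), bracket = fv_bracket\<rparr>"

definition has_level :: "(fv, 'm::complex_vector) supermodule \<Rightarrow> complex \<Rightarrow> bool" where
  "has_level M l \<longleftrightarrow> (\<forall>v\<in>mspace M. act M \<z> v = l *\<^sub>C v)"

definition smooth_FV :: "(fv, 'm::complex_vector) supermodule \<Rightarrow> bool" where
  "smooth_FV M \<longleftrightarrow> (\<forall>v\<in>mspace M. \<exists>n::nat.
     (\<forall>i. i > int n \<longrightarrow> act M (L i) v = 0) \<and>
     (\<forall>j. half j > (of_nat n :: rat) \<longrightarrow> act M (\<psi> j) v = 0))"

definition smooth_Vir :: "(fv, 'm::complex_vector) supermodule \<Rightarrow> bool" where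
  "smooth_Vir V \<longleftrightarrow> (\<forall>v\<in>mspace V. \<exists>n::nat. \<forall>i. i > int n \<longrightarrow> act V (L i) v = 0)"

definition sigma :: "complex \<Rightarrow> fv \<Rightarrow> fv" where
  "sigma \<mu> = lin_ext (\<lambda>b. case b of
     gL k \<Rightarrow> L k | gPsi l \<Rightarrow> \<mu> *\<^sub>C \<psi> l | gC \<Rightarrow> \<c> | gZ \<Rightarrow> \<mu>\<^sup>2 *\<^sub>C \<z>)"

definition twist :: "complex \<Rightarrow> (fv, 'm) supermodule \<Rightarrow> (fv, 'm) supermodule" where
  "twist \<mu> W = \<lparr>part = part W, act = (\<lambda>x. act W (sigma \<mu> x))\<rparr>"

text \<open>The extension of a module over the Virasoro algebra on which \<open>\<psi> l\<close> and \<open>\<z>\<close> act as 0.\<close>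

definition vir_proj :: "fv \<Rightarrow> fv" where
  "vir_proj = lin_ext (\<lambda>b. case b of gL k \<Rightarrow> L k | gPsi l \<Rightarrow> 0 | gC \<Rightarrow> \<c> | gZ \<Rightarrow> 0)"

definition inflate :: "(fv, 'm) supermodule \<Rightarrow> (fv, 'm) supermodule" where
  "inflate V = \<lparr>part = part V, act = (\<lambda>x. act V (vir_proj x))\<rparr>"


section \<open>The Fock module\<close>

text \<open>The exterior algebra on odd generators $\xi_{n+1/2}$, \<open>n :: nat\<close>. The basis vector indexed
  by a finite set $\{n_1 < \dots < n_r\}$ is the monomial $\xi_{n_1+1/2} \cdots \xi_{n_r+1/2}$.\<close>

type_synonym ext = "nat fset \<Rightarrow>\<^sub>0 complex"

abbreviation \<xi> :: "nat \<Rightarrow> ext" where "\<xi> n \<equiv> basis_vec {|n|}"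

definition ext_mult :: "ext \<Rightarrow> ext \<Rightarrow> ext"  (infixl "\<cdot>" 70) where
  "x \<cdot> y = lin_ext (\<lambda>S. lin_ext (\<lambda>T.
     if S |\<inter>| T = {||}
     then (- 1) ^ card {(s, t). s |\<in>| S \<and> t |\<in>| T \<and> t < s} *\<^sub>C basis_vec (S |\<union>| T)
     else 0) y) x"

text \<open>The odd derivation $\partial / \partial \xi_{n+1/2}$.\<close>

definition ext_deriv :: "nat \<Rightarrow> ext \<Rightarrow> ext" where
  "ext_deriv n = lin_ext (\<lambda>S.
     if n |\<in>| S then (- 1) ^ card {s. s |\<in>| S \<and> s < n} *\<^sub>C basis_vec (S |-| {|n|}) else 0)"

definition ext_part :: "ext super" where
  "ext_part i = cspan {basis_vec S | S. of_nat (fcard S) = i}"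

text \<open>Note $-(k + \frac12) = (-k-1) + \frac12$.\<close>

definition psi_op :: "int \<Rightarrow> ext \<Rightarrow> ext" where
  "psi_op k u = (if k \<ge> 0 then ext_deriv (nat k) u else \<xi> (nat (- k - 1)) \<cdot> u)"

definition normal_ordered :: "int \<Rightarrow> int \<Rightarrow> ext \<Rightarrow> ext" where
  "normal_ordered j k u = (if k \<ge> j then psi_op j (psi_op k u) else - psi_op k (psi_op j u))"

text \<open>The sum ranges over $j + \frac12$, \<open>j :: int\<close>; applied to a vector only finitely many summands
  are nonzero.\<close>

definition L_op :: "int \<Rightarrow> ext \<Rightarrow> ext" where
  "L_op k u = (1 / 2) *\<^sub>C (Sum_any (\<lambda>j. half j *\<^sub>C normal_ordered (- j - 1) (j + k) u))"

definition Fock :: "(fv, ext) supermodule" where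
  "Fock = \<lparr>part = ext_part,
     act = (\<lambda>x u. lin_ext (\<lambda>b. case b of
       gL k \<Rightarrow> L_op k u | gPsi n \<Rightarrow> psi_op n u | gC \<Rightarrow> (1 / 2) *\<^sub>C u | gZ \<Rightarrow> u) x)\<rparr>"

end

theory Submission
  imports Defs
begin

text \<open>
  Since \<open>\<lambda> \<noteq> 0\<close>, the operators $\mu^{-1}\psi_n$ with $\mu^2 = \lambda$ satisfy the canonical
  anticommutation relations on \<open>M\<close>. Smoothness gives vectors killed by all $\psi_n$, $n > 0$, and on the
  space \<open>V\<close> of these vacuum vectors the creation operators define a bilinear map
  \<open>B\<close> from the Fock space and \<open>V\<close> to \<open>M\<close>, intertwining the $\psi_n$. The defect
  $\ell_k v = L_k v - B(\bar L_k 1, v)$ maps \<open>V\<close> to itself, because $L_k$ and $\bar L_k$ have the same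
  commutators with the $\psi_n$; for the same reason $L_k B(u,v) = B(\bar L_k u, v) + B(u, \ell_k v)$.
  Comparing the Virasoro relations of $L_k$ with those of $\bar L_k$ on the vacuum \<open>1\<close> shows that the
  $\ell_k$ represent the Virasoro algebra with central charge $c - \frac12$. For every submodule \<open>N\<close> of
  \<open>V\<close> the span of $B(u,v)$, $v \in N$, is a submodule of the simple module \<open>M\<close>; this yields both the
  surjectivity of \<open>B\<close> and the simplicity of \<open>V\<close>. Linear independence of the creation monomials over \<open>V\<close>,
  seen by applying annihilation operators, yields injectivity.
\<close>

section \<open>The Fock space\<close>

text \<open>The sign of moving the generator with index \<open>n\<close> past those of smaller index
  in the monomial of \<open>S\<close>. Both \<open>ext_mult\<close> and \<open>ext_deriv\<close>
  produce it on basis vectors.\<close>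

definition below_sign :: "nat \<Rightarrow> nat fset \<Rightarrow> complex" where
  "below_sign n S = (- 1) ^ card {t. t |\<in>| S \<and> t < n}"

lemma below_sign_finsert:
  assumes "m |\<notin>| S"
  shows "below_sign n (finsert m S) = (if m < n then - below_sign n S else below_sign n S)"
proof -
  have eq: "{t. t |\<in>| finsert m S \<and> t < n} =
      (if m < n then insert m {t. t |\<in>| S \<and> t < n} else {t. t |\<in>| S \<and> t < n})"
    by auto
  have "finite {t. t |\<in>| S \<and> t < n}" by (rule finite_subset[of _ "fset S"]) auto
  then show ?thesis using assms unfolding below_sign_def eq by auto
qed

lemma below_sign_fminus:
  assumes "m |\<in>| S"
  shows "below_sign n (S |-| {|m|}) = (if m < n then - below_sign n S else below_sign n S)"
proof -
  have "finsert m (S |-| {|m|}) = S" using assms by auto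
  then have "below_sign n S = (if m < n then - below_sign n (S |-| {|m|}) else below_sign n (S |-| {|m|}))"
    using below_sign_finsert[of m "S |-| {|m|}" n] by simp
  then show ?thesis by (simp split: if_splits)
qed

lemma below_sign_square [simp]: "below_sign n S * below_sign n S = 1"
  by (simp add: below_sign_def power_mult_distrib[symmetric])

lemma below_sign_finsert_self [simp]: "below_sign n (finsert n S) = below_sign n S"
proof (cases "n |\<in>| S")
  case True
  then have "finsert n S = S" by auto
  then show ?thesis by (simp only:)
qed (simp add: below_sign_finsert)

text \<open>Stated for any type of basis symbols, because the same linear induction serves the Fock
  space and the algebra \<open>fv\<close>.\<close>

lemma ext_induct [case_names zero basis add]:
  fixes u :: "'b \<Rightarrow>\<^sub>0 complex"
  assumes "P 0" "\<And>S. P (basis_vec S)" "\<And>c u u'. P u \<Longrightarrow> P u' \<Longrightarrow> P (c *\<^sub>C u + u')"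
  shows "P u"
  using fv_span[of u]
  by (induction rule: complex_vector.span_induct_alt) (use assms in auto)

lemma ext_deriv_basis:
  "ext_deriv n (basis_vec S) =
    (if n |\<in>| S then below_sign n S *\<^sub>C basis_vec (S |-| {|n|}) else 0)"
  by (simp add: ext_deriv_def below_sign_def)

lemma xi_mult_basis:
  "\<xi> n \<cdot> basis_vec S = (if n |\<in>| S then 0 else below_sign n S *\<^sub>C basis_vec (finsert n S))"
proof -
  have "{(s, t). s |\<in>| {|n|} \<and> t |\<in>| S \<and> t < s} = Pair n ` {t. t |\<in>| S \<and> t < n}" by auto
  then have "card {(s, t). s |\<in>| {|n|} \<and> t |\<in>| S \<and> t < s} = card {t. t |\<in>| S \<and> t < n}"
    by (simp add: card_image inj_on_def)
  then show ?thesis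
    by (auto simp add: ext_mult_def below_sign_def)
qed

lemma psi_op_add: "psi_op n (u + v) = psi_op n u + psi_op n v"
  by (simp add: psi_op_def ext_deriv_def ext_mult_def lin_ext_add lin_ext_fun_add)

lemma psi_op_scaleC: "psi_op n (c *\<^sub>C u) = c *\<^sub>C psi_op n u"
  by (simp add: psi_op_def ext_deriv_def ext_mult_def lin_ext_scaleC lin_ext_fun_scaleC)

lemma psi_op_0 [simp]: "psi_op n 0 = 0"
  using psi_op_scaleC[of n 0 0] by simp

lemma psi_op_uminus: "psi_op n (- u) = - psi_op n u"
  using psi_op_scaleC[of n "- 1" u] by simp

lemma psi_op_diff: "psi_op n (u - v) = psi_op n u - psi_op n v"
  using psi_op_add[of n u "- v"] by (simp add: psi_op_uminus)

lemma psi_op_sum: "psi_op n (\<Sum>i\<in>A. f i) = (\<Sum>i\<in>A. psi_op n (f i))"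
  by (induction A rule: infinite_finite_induct) (simp_all add: psi_op_add)

lemma psi_op_annihilation:
  "psi_op (int n) (basis_vec S) =
    (if n |\<in>| S then below_sign n S *\<^sub>C basis_vec (S |-| {|n|}) else 0)"
  by (simp add: psi_op_def ext_deriv_basis)

lemma psi_op_creation:
  "psi_op (- int n - 1) (basis_vec S) =
    (if n |\<in>| S then 0 else below_sign n S *\<^sub>C basis_vec (finsert n S))"
  by (simp add: psi_op_def xi_mult_basis)

text \<open>The encoded mode \<open>int n\<close> stands for n + 1/2 and annihilates;
  \<open>- int n - 1\<close> stands for -(n + 1/2) and creates the generator with index
  \<open>n\<close>.\<close>

lemma mode_cases:
  obtains (annihilation) n where "k = int n" | (creation) n where "k = - int n - 1"
proof (cases k)
  case (neg n)
  then show ?thesis using that(2)[of n] by simp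
qed (use that in blast)

lemma fminus_commute: "S |-| {|a|} |-| {|b|} = S |-| {|b|} |-| {|a|}"
  by auto

lemma finsert_fminus_commute: "a \<noteq> b \<Longrightarrow> finsert a S |-| {|b|} = finsert a (S |-| {|b|})"
  by auto

text \<open>The condition \<open>m + n = - 1\<close> says that the encoded half-integers add up to
  0. Modes on different generators reach the same set in either order; inserting or removing the
  smaller index flips the sign of the larger one, so the two orders cancel. If a creation and an
  annihilation share their generator, exactly one order survives and its sign is squared.\<close>

lemma psi_op_anticommute_basis:
  "psi_op m (psi_op n (basis_vec S)) + psi_op n (psi_op m (basis_vec S)) =
    (if m + n = - 1 then basis_vec S else 0)"
proof -
  note simps = psi_op_annihilation psi_op_creation psi_op_scaleC below_sign_fminus
    below_sign_finsert finsert_absorb mult.commute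
  have mixed: "psi_op (int a) (psi_op (- int b - 1) (basis_vec S))
      + psi_op (- int b - 1) (psi_op (int a) (basis_vec S)) = (if a = b then basis_vec S else 0)" for a b
  proof (cases "a = b")
    case True
    then show ?thesis by (simp add: simps)
  next
    case False
    then show ?thesis by (simp add: simps finsert_fminus_commute)
  qed
  show ?thesis
  proof (cases m rule: mode_cases; cases n rule: mode_cases)
    fix a b assume m: "m = int a" and n: "n = int b"
    show ?thesis unfolding m n
      by (cases a b rule: linorder_cases) (auto simp add: simps fminus_commute[of S a b])
  next
    fix a b assume m: "m = - int a - 1" and n: "n = - int b - 1"
    show ?thesis unfolding m n
      by (cases a b rule: linorder_cases) (auto simp add: simps finsert_commute[of a b])
  next
    fix a b assume m: "m = int a" and n: "n = - int b - 1"
    show ?thesis unfolding m n using mixed[of a b] by simp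
  next
    fix a b assume m: "m = - int a - 1" and n: "n = int b"
    show ?thesis unfolding m n using mixed[of b a] by (auto simp: add.commute)
  qed
qed

lemma psi_op_anticommute:
  "psi_op m (psi_op n u) + psi_op n (psi_op m u) = (if m + n = - 1 then u else 0)"
proof (induction u rule: ext_induct)
  case (add c u u')
  have "psi_op m (psi_op n (c *\<^sub>C u + u')) + psi_op n (psi_op m (c *\<^sub>C u + u')) =
    c *\<^sub>C (psi_op m (psi_op n u) + psi_op n (psi_op m u)) + (psi_op m (psi_op n u') + psi_op n (psi_op m u'))"
    by (simp add: psi_op_add psi_op_scaleC complex_vector.scale_right_distrib)
  then show ?case unfolding add by auto
qed (simp_all add: psi_op_anticommute_basis)

lemma psi_op_smooth: "\<exists>N. \<forall>j\<ge>N. psi_op j u = 0"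
proof (induction u rule: ext_induct)
  case (basis S)
  obtain N where N: "\<forall>n\<in>fset S. n < N" using finite_nat_set_iff_bounded[of "fset S"] by auto
  have "psi_op j (basis_vec S) = 0" if "j \<ge> int N" for j
  proof -
    have "nat j |\<notin>| S" using N that by fastforce
    then show ?thesis using psi_op_annihilation[of "nat j" S] that by simp
  qed
  then show ?case by blast
next
  case (add c u u')
  then obtain N N' where "\<forall>j\<ge>N. psi_op j u = 0" "\<forall>j\<ge>N'. psi_op j u' = 0" by blast
  then have "\<forall>j\<ge>max N N'. psi_op j (c *\<^sub>C u + u') = 0" by (simp add: psi_op_add psi_op_scaleC)
  then show ?case by blast
qed simp

section \<open>Normal ordering and the operators \<open>L_op\<close>\<close>

lemma normal_ordered_add: "normal_ordered j k (u + v) = normal_ordered j k u + normal_ordered j k v"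
  by (simp add: normal_ordered_def psi_op_add)

lemma normal_ordered_scaleC: "normal_ordered j k (c *\<^sub>C u) = c *\<^sub>C normal_ordered j k u"
  by (simp add: normal_ordered_def psi_op_scaleC)

lemma normal_ordered_eq: "j + k \<noteq> - 1 \<Longrightarrow> normal_ordered j k u = psi_op j (psi_op k u)"
  using psi_op_anticommute[of j k u] by (simp add: normal_ordered_def minus_unique add.commute)

text \<open>In normal order the mode with the larger index acts first, and for large absolute values
  of \<open>j\<close> this index reaches the bound of \<open>psi_op_smooth\<close>.\<close>

lemma finite_normal_ordered: "finite {j. normal_ordered (- j - 1) (j + k) u \<noteq> 0}"
proof -
  obtain N where N: "\<And>j. j \<ge> N \<Longrightarrow> psi_op j u = 0" using psi_op_smooth by blast
  let ?B = "\<bar>N\<bar> + \<bar>k\<bar> + 1"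
  have "normal_ordered (- j - 1) (j + k) u = 0" if "\<bar>j\<bar> > ?B" for j
  proof (cases "j + k \<ge> - j - 1")
    case True
    then have "j + k \<ge> N" using that by linarith
    then show ?thesis using True N by (simp add: normal_ordered_def)
  next
    case False
    then have "- j - 1 \<ge> N" using that by linarith
    then show ?thesis using False N by (simp add: normal_ordered_def)
  qed
  then have "{j. normal_ordered (- j - 1) (j + k) u \<noteq> 0} \<subseteq> {- ?B .. ?B}" by force
  then show ?thesis by (rule finite_subset) simp
qed

text \<open>Any finite set containing the support may serve as index range, so sums belonging to
  different vectors can be compared over a common set.\<close>

lemma L_op_eq_sum:
  assumes "finite A" "{j. normal_ordered (- j - 1) (j + k) u \<noteq> 0} \<subseteq> A"
  shows "L_op k u = (1 / 2) *\<^sub>C (\<Sum>j\<in>A. half j *\<^sub>C normal_ordered (- j - 1) (j + k) u)"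
proof -
  have "{j. half j *\<^sub>C normal_ordered (- j - 1) (j + k) u \<noteq> 0} \<subseteq> A" using assms(2) by force
  then have "Sum_any (\<lambda>j. half j *\<^sub>C normal_ordered (- j - 1) (j + k) u)
      = (\<Sum>j\<in>A. half j *\<^sub>C normal_ordered (- j - 1) (j + k) u)"
    by (rule Sum_any.expand_superset[OF assms(1)])
  then show ?thesis by (simp only: L_op_def)
qed

lemma L_op_add: "L_op k (u + v) = L_op k u + L_op k v"
proof -
  let ?A = "{j. normal_ordered (- j - 1) (j + k) u \<noteq> 0} \<union> {j. normal_ordered (- j - 1) (j + k) v \<noteq> 0}"
  have fin: "finite ?A" by (simp add: finite_normal_ordered)
  have sub: "{j. normal_ordered (- j - 1) (j + k) (u + v) \<noteq> 0} \<subseteq> ?A"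
    by (auto simp: normal_ordered_add)
  show ?thesis
    unfolding L_op_eq_sum[OF fin Un_upper1] L_op_eq_sum[OF fin Un_upper2] L_op_eq_sum[OF fin sub]
    by (simp only: normal_ordered_add complex_vector.scale_right_distrib sum.distrib)
qed

lemma L_op_scaleC: "L_op k (c *\<^sub>C u) = c *\<^sub>C L_op k u"
proof -
  let ?A = "{j. normal_ordered (- j - 1) (j + k) u \<noteq> 0}"
  have sub: "{j. normal_ordered (- j - 1) (j + k) (c *\<^sub>C u) \<noteq> 0} \<subseteq> ?A"
    by (auto simp: normal_ordered_scaleC)
  show ?thesis
    unfolding L_op_eq_sum[OF finite_normal_ordered subset_refl, of k u] L_op_eq_sum[OF finite_normal_ordered sub]
    by (simp only: normal_ordered_scaleC complex_vector.scale_sum_right scaleC_scaleC mult_ac)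
qed

lemma L_op_0 [simp]: "L_op k 0 = 0"
  using L_op_scaleC[of k 0 0] by simp

lemma L_op_sum: "L_op k (\<Sum>i\<in>A. f i) = (\<Sum>i\<in>A. L_op k (f i))"
  by (induction A rule: infinite_finite_induct) (simp_all add: L_op_add)

text \<open>Moving \<open>psi_op n\<close> out past both factors leaves one contraction for each.
  The two branches of the normal ordering give the same terms, since they differ by a scalar, which
  commutes with \<open>psi_op n\<close>.\<close>

lemma normal_ordered_psi_op:
  "normal_ordered a b (psi_op n u) =
    psi_op n (normal_ordered a b u) + ((if b + n = - 1 then psi_op a u else 0)
      - (if a + n = - 1 then psi_op b u else 0))"
proof -
  have an: "psi_op a (psi_op n w) = (if a + n = - 1 then w else 0) - psi_op n (psi_op a w)" for w
    using psi_op_anticommute[of a n w] by (simp add: eq_diff_eq)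
  have bn: "psi_op b (psi_op n w) = (if b + n = - 1 then w else 0) - psi_op n (psi_op b w)" for w
    using psi_op_anticommute[of b n w] by (simp add: eq_diff_eq)
  show ?thesis
    by (simp add: normal_ordered_def an bn psi_op_diff psi_op_uminus)
qed

text \<open>The relation between L_k and the modes in the algebra. In the sum defining
  \<open>L_op\<close> only \<open>j = n\<close> and \<open>j = - n - k - 1\<close> contribute
  contractions.\<close>

lemma L_op_psi_op:
  "L_op k (psi_op n u) = psi_op n (L_op k u) - (half n + of_int k / 2) *\<^sub>C psi_op (n + k) u"
proof -
  let ?N = "\<lambda>j. normal_ordered (- j - 1) (j + k)"
  \<comment> \<open>The two contraction indices are added so that each of the delta sums below picks
    up its term.\<close>
  let ?A = "{j. ?N j u \<noteq> 0} \<union> {j. ?N j (psi_op n u) \<noteq> 0} \<union> {- n - k - 1, n}"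
  have fin: "finite ?A" by (simp add: finite_normal_ordered)
  have sub: "{j. ?N j u \<noteq> 0} \<subseteq> ?A" "{j. ?N j (psi_op n u) \<noteq> 0} \<subseteq> ?A" by blast+
  have pointwise: "half j *\<^sub>C ?N j (psi_op n u) = half j *\<^sub>C psi_op n (?N j u)
      + ((if j = - n - k - 1 then half j *\<^sub>C psi_op (n + k) u else 0)
       - (if j = n then half j *\<^sub>C psi_op (n + k) u else 0))" for j
  proof -
    have "j + k + n = - 1 \<longleftrightarrow> j = - n - k - 1" "- j - 1 + n = - 1 \<longleftrightarrow> j = n" by auto
    moreover have "- j - 1 = n + k" if "j = - n - k - 1" using that by simp
    ultimately show ?thesis
      by (simp only: normal_ordered_psi_op complex_vector.scale_right_distrib
          complex_vector.scale_right_diff_distrib if_distrib[of "scaleC _"] complex_vector.scale_zero_right)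
        (auto simp: add.commute)
  qed
  have "(\<Sum>j\<in>?A. half j *\<^sub>C ?N j (psi_op n u)) = (\<Sum>j\<in>?A. half j *\<^sub>C psi_op n (?N j u))
      + ((\<Sum>j\<in>?A. if j = - n - k - 1 then half j *\<^sub>C psi_op (n + k) u else 0)
       - (\<Sum>j\<in>?A. if j = n then half j *\<^sub>C psi_op (n + k) u else 0))"
    unfolding sum.distrib[symmetric] sum_subtractf[symmetric]
    by (rule sum.cong[OF refl]) (rule pointwise)
  also have "(\<Sum>j\<in>?A. if j = - n - k - 1 then half j *\<^sub>C psi_op (n + k) u else 0)
      = half (- n - k - 1) *\<^sub>C psi_op (n + k) u"
    using fin by (subst sum.delta) auto
  also have "(\<Sum>j\<in>?A. if j = n then half j *\<^sub>C psi_op (n + k) u else 0) = half n *\<^sub>C psi_op (n + k) u"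
    using fin by (subst sum.delta) auto
  also have "(\<Sum>j\<in>?A. half j *\<^sub>C psi_op n (?N j u)) = psi_op n (\<Sum>j\<in>?A. half j *\<^sub>C ?N j u)"
    by (simp add: psi_op_sum psi_op_scaleC)
  finally have "(1 / 2 :: complex) *\<^sub>C (\<Sum>j\<in>?A. half j *\<^sub>C ?N j (psi_op n u)) =
      psi_op n ((1 / 2) *\<^sub>C (\<Sum>j\<in>?A. half j *\<^sub>C ?N j u)) +
      (1 / 2) *\<^sub>C ((half (- n - k - 1) - half n) *\<^sub>C psi_op (n + k) u)"
    by (simp only: psi_op_scaleC complex_vector.scale_right_distrib complex_vector.scale_left_diff_distrib)
  moreover have "(1 / 2 :: complex) * (half (- n - k - 1) - half n) = - (half n + of_int k / 2)"
    by (simp add: half_def field_simps)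
  ultimately show ?thesis
    unfolding L_op_eq_sum[OF fin sub(1)] L_op_eq_sum[OF fin sub(2)]
    by (simp only: scaleC_scaleC complex_vector.scale_minus_left) simp
qed

section \<open>The vacuum of the Fock space and the Virasoro relation on it\<close>

abbreviation vac :: ext where "vac \<equiv> basis_vec {||}"

lemma psi_op_vac: "n \<ge> 0 \<Longrightarrow> psi_op n vac = 0"
  using psi_op_annihilation[of "nat n" "{||}"] by simp

lemma lookup_annihilation:
  "Poly_Mapping.lookup (psi_op (int n) u) T =
    (if n |\<in>| T then 0 else below_sign n T * Poly_Mapping.lookup u (finsert n T))"
proof (induction u rule: ext_induct)
  case (basis S)
  show ?case
  proof (cases "n |\<in>| S")
    case True
    then have "S |-| {|n|} = T \<longleftrightarrow> n |\<notin>| T \<and> S = finsert n T" by auto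
    moreover have "n |\<notin>| T \<Longrightarrow> below_sign n T = below_sign n (finsert n T)" by simp
    ultimately show ?thesis
      using True by (auto simp: psi_op_annihilation lookup_simps simp del: below_sign_finsert_self)
  next
    case False
    then show ?thesis by (auto simp: psi_op_annihilation lookup_simps)
  qed
qed (simp_all add: psi_op_add psi_op_scaleC lookup_simps algebra_simps)

lemma lookup_creation:
  assumes "n < 0"
  shows "Poly_Mapping.lookup (psi_op n u) {||} = 0"
proof (induction u rule: ext_induct)
  case (basis S)
  show ?case using assms psi_op_creation[of "nat (- n - 1)" S] by (simp add: lookup_simps)
qed (simp_all add: psi_op_add psi_op_scaleC lookup_simps)

text \<open>The vacuum is unique up to scalars: the coefficient of a nonempty set \<open>S\<close>
  reappears, up to sign, after annihilating an element of \<open>S\<close>.\<close>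

lemma vacuum_vector:
  assumes "\<And>n. n \<ge> 0 \<Longrightarrow> psi_op n u = 0"
  shows "u = Poly_Mapping.lookup u {||} *\<^sub>C vac"
proof (rule poly_mapping_eqI)
  fix S
  show "Poly_Mapping.lookup u S = Poly_Mapping.lookup (Poly_Mapping.lookup u {||} *\<^sub>C vac) S"
  proof (cases "S = {||}")
    case False
    then obtain n T where S: "S = finsert n T" "n |\<notin>| T" by (cases S rule: fset_strong_cases) auto
    then have "below_sign n T * Poly_Mapping.lookup u S = 0"
      using lookup_annihilation[of n u T] assms[of "int n"] by simp
    then have "Poly_Mapping.lookup u S = 0" by (simp add: below_sign_def)
    then show ?thesis using False by (simp add: lookup_simps)
  qed (simp add: lookup_simps)
qed

text \<open>The encoded indices \<open>- j - 1\<close> and \<open>j + k\<close> add up to at least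
  -1, so the larger one, which acts first, is an annihilation mode.\<close>

lemma L_op_vac_nonneg: "k \<ge> 0 \<Longrightarrow> L_op k vac = 0"
  by (subst L_op_eq_sum[of "{}"]) (auto simp: normal_ordered_def psi_op_vac split: if_splits)

text \<open>A summand survives only if both of its modes create. The encoded indices add up to
  \<open>k - 1\<close>, which differs from -1, so the normal-ordered product is the ordinary
  one.\<close>

lemma L_op_vac_neg:
  assumes "k < 0"
  shows "L_op k vac = (1 / 2) *\<^sub>C (\<Sum>j\<in>{0..<- k}. half j *\<^sub>C psi_op (- j - 1) (psi_op (j + k) vac))"
proof -
  have "normal_ordered (- j - 1) (j + k) vac = 0" if "j \<notin> {0..<- k}" for j
    using that assms by (auto simp: normal_ordered_def psi_op_vac)
  moreover have "normal_ordered (- j - 1) (j + k) vac = psi_op (- j - 1) (psi_op (j + k) vac)" for j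
    using assms by (intro normal_ordered_eq) simp
  ultimately show ?thesis by (subst L_op_eq_sum[of "{0..<- k}"]) fastforce+
qed

lemma lookup_L_op_vac: "Poly_Mapping.lookup (L_op k vac) {||} = 0"
proof (cases "k \<ge> 0")
  case False
  then show ?thesis
    by (auto simp: L_op_vac_neg lookup_simps lookup_sum lookup_creation intro!: sum.neutral)
qed (simp add: L_op_vac_nonneg)

text \<open>For \<open>x = M / 2\<close> the value is (M^3 - M)/12, twice the central term of the
  Virasoro relation at central charge 1/2.\<close>

lemma sum_half_product:
  "(\<Sum>j\<in>{0..<int M}. half j * (half j - x)) =
     (of_nat M * (4 * of_nat M ^ 2 - 1) / 12 - x * of_nat M ^ 2 / 2 :: complex)"
proof (induction M)
  case (Suc M)
  have "{0..<int (Suc M)} = insert (int M) {0..<int M}" by auto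
  then have step: "(\<Sum>j\<in>{0..<int (Suc M)}. half j * (half j - x)) =
      half (int M) * (half (int M) - x) + (\<Sum>j\<in>{0..<int M}. half j * (half j - x))"
    by (simp only:) simp
  show ?case unfolding step Suc.IH by (simp add: half_def field_simps power2_eq_square)
qed simp

text \<open>Commuting \<open>L_op m\<close> past the first creation operator of a summand leaves a
  term that starts with this operator, hence has no vacuum component, and a term with a shifted
  mode. The shifted mode contracts with the second creation operator exactly if
  \<open>m = - n\<close>.\<close>

lemma lookup_L_op_L_op_vac:
  assumes "n < 0"
  shows "Poly_Mapping.lookup (L_op m (L_op n vac)) {||} =
    (if m = - n then (of_int (m ^ 3 - m) / 24) else 0)"
proof -
  let ?p = "\<lambda>j. psi_op (- j - 1) (psi_op (j + n) vac)"
  have *: "Poly_Mapping.lookup (L_op m (?p j)) {||} = (if m = - n then half j - of_int m / 2 else 0)"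
    if j: "j \<in> {0..<- n}" for j
  proof -
    have "psi_op (- j - 1 + m) (psi_op (j + n) vac) = (if m = - n then vac else 0)
        - psi_op (j + n) (psi_op (- j - 1 + m) vac)"
      using psi_op_anticommute[of "- j - 1 + m" "j + n" vac] by (auto simp: eq_diff_eq)
    then have "Poly_Mapping.lookup (psi_op (- j - 1 + m) (psi_op (j + n) vac)) {||} = (if m = - n then 1 else 0)"
      using j by (simp add: lookup_simps lookup_creation)
    moreover have "- (half (- j - 1) + of_int m / 2 :: complex) = half j - of_int m / 2"
      by (simp add: half_def field_simps)
    ultimately show ?thesis
      using j by (simp add: L_op_psi_op[of m "- j - 1"] lookup_simps lookup_creation)
  qed
  have "Poly_Mapping.lookup (L_op m (L_op n vac)) {||} =
      (1 / 2) * (\<Sum>j\<in>{0..<- n}. half j * (if m = - n then half j - of_int m / 2 else 0))"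
    by (simp add: L_op_vac_neg[OF assms] L_op_scaleC L_op_sum lookup_simps lookup_sum *)
  also have "\<dots> = (if m = - n then (of_int (m ^ 3 - m) / 24) else 0)"
  proof (cases "m = - n")
    case True
    then have "m = int (nat m)" using assms by simp
    then obtain M where M: "m = int M" by blast
    then show ?thesis using True sum_half_product[where M = M and x = "of_int m / 2"]
      by (auto simp add: power2_eq_square power3_eq_cube algebra_simps)
  qed simp
  finally show ?thesis .
qed

text \<open>\<open>D\<close> measures the failure of the Virasoro relation without central term. It
  commutes with the modes because the coefficients \<open>a k r\<close> that appear when modes are
  shifted obey the same bracket relation.\<close>

lemma L_op_commutator_psi_op:
  fixes m n r
  defines "D u \<equiv> L_op m (L_op n u) - L_op n (L_op m u) - of_int (m - n) *\<^sub>C L_op (m + n) u"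
  shows "psi_op r (D u) = D (psi_op r u)"
proof -
  define a where "a k r = (half r + of_int k / 2 :: complex)" for k r
  have p: "psi_op r (L_op k u) = L_op k (psi_op r u) + a k r *\<^sub>C psi_op (r + k) u" for k r u
    using L_op_psi_op[of k r u] by (simp add: a_def)
  have "a m r * a n (r + m) - a n r * a m (r + n) = of_int (m - n) * a (m + n) r"
    by (simp add: a_def half_def field_simps)
  then have coeff: "(a m r * a n (r + m)) *\<^sub>C w = (a n r * a m (r + n)) *\<^sub>C w + (of_int (m - n) * a (m + n) r) *\<^sub>C w"
    for w :: ext
    by (metis add.commute complex_vector.scale_left_distrib diff_add_cancel)
  have assoc: "r + n + m = r + m + n" "r + (m + n) = r + m + n" by simp_all
  show ?thesis unfolding D_def
    by (simp add: p psi_op_diff psi_op_scaleC L_op_add L_op_scaleC coeff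
        complex_vector.scale_right_distrib assoc del: of_int_diff)
qed

text \<open>As \<open>D\<close> commutes with the modes, \<open>D vac\<close> is killed by all
  annihilations and is a multiple of \<open>vac\<close>; the multiple is read off as its vacuum
  coefficient.\<close>

lemma L_op_commutator_vac:
  "L_op m (L_op n vac) - L_op n (L_op m vac) =
    of_int (m - n) *\<^sub>C L_op (m + n) vac + (if m = - n then of_int (m ^ 3 - m) / 24 else 0) *\<^sub>C vac"
proof -
  define D where "D u = L_op m (L_op n u) - L_op n (L_op m u) - of_int (m - n) *\<^sub>C L_op (m + n) u" for u
  have "D vac = Poly_Mapping.lookup (D vac) {||} *\<^sub>C vac"
  proof (rule vacuum_vector)
    fix k :: int assume "k \<ge> 0"
    then show "psi_op k (D vac) = 0"
      using L_op_commutator_psi_op[of k m n vac] by (simp add: D_def psi_op_vac)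
  qed
  moreover have "Poly_Mapping.lookup (D vac) {||} = (if m = - n then of_int (m ^ 3 - m) / 24 else 0)"
  proof -
    have nonneg: "Poly_Mapping.lookup (L_op i (L_op j vac)) {||} = 0" if "j \<ge> 0" for i j
      using that by (simp add: L_op_vac_nonneg)
    consider "m \<ge> 0" "n \<ge> 0" | "m < 0" "n \<ge> 0" | "m \<ge> 0" "n < 0" | "m < 0" "n < 0" by linarith
    then show ?thesis
      by cases (auto simp: D_def lookup_simps lookup_L_op_vac nonneg lookup_L_op_L_op_vac field_simps)
  qed
  ultimately show ?thesis by (simp add: D_def algebra_simps)
qed

section \<open>Parity of the Fock operators\<close>

lemma bit_add_one_add_one: "i + 1 + 1 = (i :: bit)"
  by (cases i) simp_all

lemma psi_op_part: "u \<in> ext_part i \<Longrightarrow> psi_op n u \<in> ext_part (i + 1)"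
  unfolding ext_part_def
proof (induction rule: complex_vector.span_induct_alt)
  case (step c x y)
  then obtain S where S: "x = basis_vec S" "of_nat (fcard S) = i" by blast
  have "psi_op n x \<in> cspan {basis_vec S |S. of_nat (fcard S) = i + 1}"
  proof (cases n rule: mode_cases)
    case (annihilation k)
    have "basis_vec (S |-| {|k|}) \<in> {basis_vec S |S. of_nat (fcard S) = i + 1}" if "k |\<in>| S"
    proof -
      have "fcard S = Suc (fcard (S |-| {|k|}))" using that by (metis fcard_Suc_fminus1)
      then have "i = of_nat (fcard (S |-| {|k|})) + 1" using S(2) by (simp only: of_nat_Suc add.commute)
      then have "of_nat (fcard (S |-| {|k|})) = i + 1" by (simp only: bit_add_one_add_one)
      then show ?thesis by blast
    qed
    then show ?thesis
      by (simp add: S(1) annihilation psi_op_annihilation complex_vector.span_zero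
          complex_vector.span_scale complex_vector.span_base del: mem_Collect_eq)
  next
    case (creation k)
    have "basis_vec (finsert k S) \<in> {basis_vec S |S. of_nat (fcard S) = i + 1}" if "k |\<notin>| S"
      using that S(2) by (auto simp: fcard_finsert_disjoint add.commute intro!: exI[of _ "finsert k S"])
    then show ?thesis
      by (simp add: S(1) creation psi_op_creation complex_vector.span_zero
          complex_vector.span_scale complex_vector.span_base del: mem_Collect_eq)
  qed
  then show ?case using step
    by (simp add: psi_op_add psi_op_scaleC complex_vector.span_add complex_vector.span_scale)
qed (simp add: complex_vector.span_zero)

lemma csubspace_ext_part: "csubspace (ext_part i)"
  unfolding ext_part_def by (rule complex_vector.subspace_span)

lemma L_op_part: "u \<in> ext_part i \<Longrightarrow> L_op k u \<in> ext_part i"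
proof -
  assume u: "u \<in> ext_part i"
  have "normal_ordered a b u \<in> ext_part i" for a b
    using psi_op_part[OF psi_op_part[OF u]]
    by (auto simp only: normal_ordered_def bit_add_one_add_one split: if_split
        intro!: complex_vector.subspace_neg[OF csubspace_ext_part])
  then show ?thesis
    by (subst L_op_eq_sum[OF finite_normal_ordered])
      (auto intro!: complex_vector.subspace_scale[OF csubspace_ext_part]
        complex_vector.subspace_sum[OF csubspace_ext_part])
qed

section \<open>Vacuum vectors\<close>

text \<open>The modes generate the Fock space from \<open>vac\<close>. This form suits statements
  proved by commuting an operator past \<open>psi_op n\<close>.\<close>

lemma fock_induct [case_names zero vac psi add]:
  assumes "P 0" "P vac" "\<And>n u. P u \<Longrightarrow> P (psi_op n u)"
    and lin: "\<And>c u u'. P u \<Longrightarrow> P u' \<Longrightarrow> P (c *\<^sub>C u + u')"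
  shows "P u"
proof (induction u rule: ext_induct)
  case (basis S)
  show ?case
  proof (induction S rule: fset_induct_stronger)
    case (insert n S)
    have "psi_op (- int n - 1) (basis_vec S) = below_sign n S *\<^sub>C basis_vec (finsert n S)"
      using insert by (simp add: psi_op_creation)
    then have "basis_vec (finsert n S) = below_sign n S *\<^sub>C psi_op (- int n - 1) (basis_vec S)" by simp
    then show ?case using lin[OF assms(3)[OF insert.IH] assms(1), of "below_sign n S" "- int n - 1"] by simp
  qed (rule assms(2))
qed (use assms in auto)

lemma clinear_onD:
  assumes "clinear_on A f" "x \<in> A"
  shows "y \<in> A \<Longrightarrow> f (x + y) = f x + f y" "f (c *\<^sub>C x) = c *\<^sub>C f x"
  using assms by (auto simp: clinear_on_def)

lemma part_whole: "csubspace (P 0) \<Longrightarrow> csubspace (P 1) \<Longrightarrow> P i \<subseteq> whole P"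
  unfolding whole_def by (cases i)
   (force intro: complex_vector.subspace_0)+

lemma csubspace_whole:
  assumes "csubspace (P 0)" "csubspace (P 1)"
  shows "csubspace (whole P)"
  unfolding whole_def using complex_vector.subspace_sums[OF assms] by (simp add: Bex_def)

text \<open>\<open>\<mu>\<close> is a fixed square root of the level. Simplicity and smoothness
  appear as hypotheses of the individual lemmas that use them.\<close>

locale level_module =
  fixes M :: "(fv, 'm::complex_vector) supermodule" and \<mu> :: complex
  assumes is_module: "is_module FV M"
    and level: "has_level M (\<mu>\<^sup>2)"
    and mu: "\<mu> \<noteq> 0"
begin

definition a :: "int \<Rightarrow> 'm \<Rightarrow> 'm" where
  "a n v = (1 / \<mu>) *\<^sub>C act M (\<psi> n) v"

text \<open>The operator of least index acts last, matching the order of the factors in the monomial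
  that the basis vector of \<open>S\<close> stands for.\<close>

definition monomial :: "nat fset \<Rightarrow> 'm \<Rightarrow> 'm" where
  "monomial S v = foldr (\<lambda>n. a (- int n - 1)) (sorted_list_of_fset S) v"

definition B :: "ext \<Rightarrow> 'm \<Rightarrow> 'm" where
  "B u v = lin_ext (\<lambda>S. monomial S v) u"

definition Vac_part :: "'m super" where
  "Vac_part i = {v \<in> part M i. \<forall>n\<ge>0. a n v = 0}"

definition ell :: "int \<Rightarrow> 'm \<Rightarrow> 'm" where
  "ell k v = act M (L k) v - B (L_op k vac) v"

text \<open>The Fock factor already carries central charge 1/2, hence the shift in the action of
  \<open>\<c>\<close>. The value 0 on the other generators is a default outside
  \<open>Vir\<close>.\<close>

definition V :: "(fv, 'm) supermodule" where
  "V = \<lparr>part = Vac_part, act = (\<lambda>x v. lin_ext (\<lambda>b. case b of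
     gL k \<Rightarrow> ell k v | gC \<Rightarrow> act M \<c> v - (1 / 2) *\<^sub>C v | _ \<Rightarrow> 0) x)\<rparr>"

lemma superspace: "superspace (part M)"
  using is_module by (simp add: is_module_def)

lemma csubspace_part: "csubspace (part M i)"
  using superspace by (cases i) (simp_all add: superspace_def)

lemma whole_FV: "whole (gpart FV) = UNIV"
  by (simp add: FV_def whole_fv)

lemma basis_gpart: "basis_vec b \<in> gpart FV (fv_parity b)"
  by (simp add: FV_def fv_part_basis)

lemma csubspace_M: "csubspace (mspace M)"
  by (simp add: csubspace_whole csubspace_part)

lemma part_M: "v \<in> part M i \<Longrightarrow> v \<in> mspace M"
  using part_whole[of "part M" i] csubspace_part by blast

lemma act_lin: "clinear_on (mspace M) (act M x)" "v \<in> mspace M \<Longrightarrow> clinear_on UNIV (\<lambda>x. act M x v)"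
  using is_module by (auto simp: is_module_def whole_FV)

lemma act_add: "v \<in> mspace M \<Longrightarrow> w \<in> mspace M \<Longrightarrow> act M x (v + w) = act M x v + act M x w"
  and act_scaleC: "v \<in> mspace M \<Longrightarrow> act M x (c *\<^sub>C v) = c *\<^sub>C act M x v"
  using clinear_onD[OF act_lin(1)] by blast+

lemma act_add_left: "v \<in> mspace M \<Longrightarrow> act M (x + y) v = act M x v + act M y v"
  and act_scaleC_left: "v \<in> mspace M \<Longrightarrow> act M (c *\<^sub>C x) v = c *\<^sub>C act M x v"
  using clinear_onD[OF act_lin(2)] by blast+

lemma act_0_left: "v \<in> mspace M \<Longrightarrow> act M 0 v = 0"
  using act_scaleC_left[of v 0 0] by simp

lemma act_0: "act M x 0 = 0"
  using act_scaleC[of 0 x 0] complex_vector.subspace_0[OF csubspace_M] by simp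

lemma act_expand: "v \<in> mspace M \<Longrightarrow> act M x v = lin_ext (\<lambda>b. act M (basis_vec b) v) x"
  by (induction x rule: ext_induct)
    (simp_all add: act_0_left act_add_left act_scaleC_left lin_ext_add lin_ext_scaleC)

lemma act_part: "v \<in> part M j \<Longrightarrow> act M (basis_vec b) v \<in> part M (fv_parity b + j)"
  using is_module basis_gpart by (auto simp: is_module_def)

lemma act_M_basis: "v \<in> mspace M \<Longrightarrow> act M (basis_vec b) v \<in> mspace M"
proof -
  assume "v \<in> mspace M"
  then obtain x y where v: "v = x + y" "x \<in> part M 0" "y \<in> part M 1" by (auto simp: whole_def)
  then have "act M (basis_vec b) v = act M (basis_vec b) x + act M (basis_vec b) y"
    by (simp add: act_add part_M)
  then show ?thesis using v act_part part_M complex_vector.subspace_add[OF csubspace_M] by metis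
qed

lemma act_bracket:
  "v \<in> mspace M \<Longrightarrow> act M (fv_gen_bracket b c) v =
    act M (basis_vec b) (act M (basis_vec c) v)
      - koszul (fv_parity b) (fv_parity c) *\<^sub>C act M (basis_vec c) (act M (basis_vec b) v)"
proof -
  assume v: "v \<in> mspace M"
  have "bracket FV (basis_vec b) (basis_vec c) = fv_gen_bracket b c"
    by (simp add: FV_def fv_bracket_basis)
  then show ?thesis using is_module v basis_gpart[of b] basis_gpart[of c]
    unfolding is_module_def by metis
qed

lemma act_diff: "v \<in> mspace M \<Longrightarrow> w \<in> mspace M \<Longrightarrow> act M x (v - w) = act M x v - act M x w"
  using act_add[of v "(- 1) *\<^sub>C w"] act_scaleC[of w x "- 1"] complex_vector.subspace_neg[OF csubspace_M]
  by simp

lemma a_M: "v \<in> mspace M \<Longrightarrow> a n v \<in> mspace M"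
  unfolding a_def by (intro complex_vector.subspace_scale[OF csubspace_M] act_M_basis)

lemma a_part: "v \<in> part M i \<Longrightarrow> a n v \<in> part M (i + 1)"
  unfolding a_def using act_part[of v i "gPsi n"]
  by (intro complex_vector.subspace_scale[OF csubspace_part]) (simp only: fv_parity.simps add.commute)

lemma a_add: "v \<in> mspace M \<Longrightarrow> w \<in> mspace M \<Longrightarrow> a n (v + w) = a n v + a n w"
  by (simp add: a_def act_add complex_vector.scale_right_distrib)

lemma a_scaleC: "v \<in> mspace M \<Longrightarrow> a n (c *\<^sub>C v) = c *\<^sub>C a n v"
  by (simp add: a_def act_scaleC mult.commute)

lemma a_0 [simp]: "a n 0 = 0"
  by (simp add: a_def act_0)

lemma a_diff: "v \<in> mspace M \<Longrightarrow> w \<in> mspace M \<Longrightarrow> a n (v - w) = a n v - a n w"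
  by (simp add: a_def act_diff complex_vector.scale_right_diff_distrib)

text \<open>The two factors \<open>1 / \<mu>\<close> turn the level \<open>\<mu>\<^sup>2\<close>
  into level 1.\<close>

lemma a_anticommute:
  assumes v: "v \<in> mspace M"
  shows "a m (a n v) + a n (a m v) = (if m + n = - 1 then v else 0)"
proof -
  have "a m (a n v) + a n (a m v) = (1 / \<mu>\<^sup>2) *\<^sub>C act M (fv_gen_bracket (gPsi m) (gPsi n)) v"
    using act_bracket[OF v, of "gPsi m" "gPsi n"]
    by (simp add: a_def act_scaleC act_M_basis v koszul_def complex_vector.scale_right_distrib
        complex_vector.scale_right_diff_distrib power2_eq_square del: fv_gen_bracket.simps)
  also have "\<dots> = (if m + n = - 1 then v else 0)"
    using level mu v by (simp add: has_level_def half_eq act_0_left)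
  finally show ?thesis .
qed

lemma act_L_a:
  assumes v: "v \<in> mspace M"
  shows "act M (L k) (a n v) = a n (act M (L k) v) - (half n + of_int k / 2) *\<^sub>C a (n + k) v"
proof -
  have "act M (L k) (act M (\<psi> n) v) - act M (\<psi> n) (act M (L k) v)
      = - (half n + of_int k / 2) *\<^sub>C act M (\<psi> (n + k)) v"
    using act_bracket[OF v, of "gL k" "gPsi n"]
    by (simp add: koszul_def act_scaleC_left v add.commute)
  then have "act M (L k) (act M (\<psi> n) v) = act M (\<psi> n) (act M (L k) v)
      - (half n + of_int k / 2) *\<^sub>C act M (\<psi> (n + k)) v"
    by (simp add: algebra_simps)
  then show ?thesis
    by (simp add: a_def act_scaleC act_M_basis v complex_vector.scale_right_diff_distrib mult.commute)
qed

lemma act_c_commute: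
  assumes v: "v \<in> mspace M"
  shows "act M (basis_vec b) (act M \<c> v) = act M \<c> (act M (basis_vec b) v)"
  using act_bracket[OF v, of gC b] by (cases b) (simp_all add: koszul_def act_0_left v)

lemma act_c_a: "v \<in> mspace M \<Longrightarrow> act M \<c> (a n v) = a n (act M \<c> v)"
  by (simp add: a_def act_scaleC act_M_basis act_c_commute)

text \<open>Vacuum vectors that need not be homogeneous. The whole of \<open>Vac_part\<close> lies
  in this set, so identities proved on it hold on \<open>V\<close>.\<close>

definition Vac :: "'m set" where
  "Vac = {v \<in> mspace M. \<forall>n\<ge>0. a n v = 0}"

lemma Vac_M: "v \<in> Vac \<Longrightarrow> v \<in> mspace M"
  by (simp add: Vac_def)

lemma a_Vac: "v \<in> Vac \<Longrightarrow> n \<ge> 0 \<Longrightarrow> a n v = 0"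
  by (simp add: Vac_def)

lemma csubspace_Vac: "csubspace Vac"
  using csubspace_M unfolding Vac_def complex_vector.subspace_def
  by (auto simp: a_add a_scaleC)

lemma csubspace_Vac_part: "csubspace (Vac_part i)"
proof -
  have "Vac_part i = part M i \<inter> Vac" by (auto simp: Vac_part_def Vac_def part_M)
  then show ?thesis
    by (simp add: complex_vector.subspace_inter csubspace_part csubspace_Vac)
qed

lemma Vac_part_M: "v \<in> Vac_part i \<Longrightarrow> v \<in> part M i"
  and Vac_part_Vac: "v \<in> Vac_part i \<Longrightarrow> v \<in> Vac"
  by (auto simp: Vac_part_def Vac_def part_M)

lemma whole_Vac_part: "v \<in> whole Vac_part \<Longrightarrow> v \<in> Vac"
  unfolding whole_def using Vac_part_Vac complex_vector.subspace_add[OF csubspace_Vac] by blast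

section \<open>Creation monomials over vacuum vectors\<close>

lemma monomial_empty [simp]: "monomial {||} v = v"
  by (simp add: monomial_def sorted_list_of_fset.rep_eq)

lemma monomial_finsert_less:
  assumes "\<forall>m|\<in>|S. n < m"
  shows "monomial (finsert n S) v = a (- int n - 1) (monomial S v)"
proof -
  have "sorted_list_of_fset (finsert n S) = insort n (sorted_list_of_fset S)"
    using assms by (auto simp: sorted_list_of_fset.rep_eq)
  also have "\<dots> = n # sorted_list_of_fset S"
    using assms by (intro insort_is_Cons) auto
  finally show ?thesis by (simp add: monomial_def)
qed

lemma monomial_M: "v \<in> mspace M \<Longrightarrow> monomial S v \<in> mspace M"
  by (induction S rule: fset_linorder_min_induct) (simp_all add: monomial_finsert_less a_M)

lemma monomial_part: "v \<in> part M i \<Longrightarrow> monomial S v \<in> part M (of_nat (fcard S) + i)"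
proof (induction S rule: fset_linorder_min_induct)
  case (finsert n S)
  then have "fcard (finsert n S) = Suc (fcard S)" by (intro fcard_finsert_disjoint) auto
  moreover have "of_nat (Suc (fcard S)) + i = of_nat (fcard S) + i + 1"
    by (simp only: of_nat_Suc ac_simps)
  moreover have "monomial (finsert n S) v = a (- int n - 1) (monomial S v)"
    using finsert by (intro monomial_finsert_less) auto
  ultimately show ?case
    using finsert a_part[of "monomial S v" "of_nat (fcard S) + i"] by (simp only:)
qed (simp only: monomial_empty fcard_fempty of_nat_0 add_0_left)

lemma monomial_add:
  "v \<in> mspace M \<Longrightarrow> w \<in> mspace M \<Longrightarrow> monomial S (v + w) = monomial S v + monomial S w"
  by (induction S rule: fset_linorder_min_induct) (simp_all add: monomial_finsert_less a_add monomial_M)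

lemma monomial_scaleC: "v \<in> mspace M \<Longrightarrow> monomial S (c *\<^sub>C v) = c *\<^sub>C monomial S v"
  by (induction S rule: fset_linorder_min_induct) (simp_all add: monomial_finsert_less a_scaleC monomial_M)

lemma monomial_0 [simp]: "monomial S 0 = 0"
  using monomial_scaleC[of 0 S 0] complex_vector.subspace_0[OF csubspace_M] by simp

lemma act_c_monomial: "v \<in> mspace M \<Longrightarrow> act M \<c> (monomial S v) = monomial S (act M \<c> v)"
  by (induction S rule: fset_linorder_min_induct) (simp_all add: monomial_finsert_less act_c_a monomial_M)

lemma a_square: "v \<in> mspace M \<Longrightarrow> n + n \<noteq> - 1 \<Longrightarrow> a n (a n v) = 0"
proof -
  assume "v \<in> mspace M" "n + n \<noteq> - 1"
  then have "2 *\<^sub>C a n (a n v) = 0" 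
    using a_anticommute[of v n n] complex_vector.scale_left_distrib[of 1 1 "a n (a n v)"] by simp
  then show ?thesis by simp
qed

text \<open>Over a vacuum vector the modes act on creation monomials as \<open>psi_op\<close> acts
  on the basis of the Fock space. The induction strips the least index, whose creation operator is
  the outermost factor.\<close>

lemma a_monomial:
  assumes v: "v \<in> Vac"
  shows "a (- int n - 1) (monomial S v) =
      (if n |\<in>| S then 0 else below_sign n S *\<^sub>C monomial (finsert n S) v)" (is "?creation S")
    and "a (int n) (monomial S v) =
      (if n |\<in>| S then below_sign n S *\<^sub>C monomial (S |-| {|n|}) v else 0)" (is "?annihilation S")
proof -
  have M: "monomial S v \<in> mspace M" for S using v by (simp add: monomial_M Vac_M)
  have "?creation S \<and> ?annihilation S"
  proof (induction S rule: fset_linorder_min_induct)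
    case fempty
    then show ?case using v monomial_finsert_less[of "{||}" n v]
      by (simp add: a_Vac below_sign_def)
  next
    case (finsert m S)
    then have less: "\<forall>k|\<in>|S. m < k" and m: "m |\<notin>| S" by auto
    \<comment> \<open>Anticommuting past the outermost factor gives a contraction for
      \<open>r = int m\<close> and otherwise only a sign, which is the contribution of
      \<open>m\<close> to \<open>below_sign\<close>.\<close>
    have step: "a r (monomial (finsert m S) v) = (if r = int m then monomial S v else 0)
        - a (- int m - 1) (a r (monomial S v))" for r
      using a_anticommute[OF M, of r "- int m - 1" S] less by (simp add: monomial_finsert_less eq_diff_eq)
    have creation: "?creation (finsert m S)"
    proof (cases n m rule: linorder_cases)
      case less1: less
      then have "\<forall>k|\<in>|finsert m S. n < k" using less by auto
      moreover from this have "{t. t |\<in>| finsert m S \<and> t < n} = {}" by auto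
      moreover have "n |\<notin>| finsert m S" using less less1 by auto
      ultimately show ?thesis
        by (simp only: monomial_finsert_less below_sign_def if_False card.empty power_0 scaleC_one)
    next
      case equal
      then show ?thesis using less M by (simp add: monomial_finsert_less a_square)
    next
      case greater
      then have "\<forall>k|\<in>|finsert n S. m < k" using less by auto
      then have "monomial (finsert m (finsert n S)) v = a (- int m - 1) (monomial (finsert n S) v)"
        by (rule monomial_finsert_less)
      then show ?thesis using greater finsert.IH m M
        by (simp add: step below_sign_finsert a_scaleC finsert_commute[of n m])
    qed
    have annihilation: "?annihilation (finsert m S)"
    proof (cases "n = m")
      case True
      have "{t. t |\<in>| finsert m S \<and> t < m} = {}" using less by auto
      then have "below_sign m (finsert m S) = 1" by (simp only: below_sign_def card.empty power_0)
      moreover have "S |-| {|m|} = S" using m by auto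
      ultimately show ?thesis using True finsert.IH m by (simp add: step)
    next
      case False
      show ?thesis
      proof (cases "n |\<in>| S")
        case True
        have "\<forall>k|\<in>|S |-| {|n|}. m < k" "m < n" using less True by auto
        then show ?thesis using True False finsert.IH m M
          by (simp add: step below_sign_finsert a_scaleC finsert_fminus_commute monomial_finsert_less)
      next
        case nS: False
        then show ?thesis using False finsert.IH by (simp add: step)
      qed
    qed
    from creation annihilation show ?case ..
  qed
  then show "?creation S" "?annihilation S" by blast+
qed

section \<open>The map \<open>B\<close> from the Fock space and the vacuum vectors to
  \<open>M\<close>\<close>

lemma B_add_left: "B (u + u') v = B u v + B u' v"
  and B_scaleC_left: "B (c *\<^sub>C u) v = c *\<^sub>C B u v"
  and B_0_left [simp]: "B 0 v = 0"
  and B_basis: "B (basis_vec S) v = monomial S v"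
  by (simp_all add: B_def lin_ext_add lin_ext_scaleC)

lemma B_uminus_left: "B (- u) v = - B u v"
  using B_scaleC_left[of "- 1" u v] by simp

lemma B_diff_left: "B (u - u') v = B u v - B u' v"
  using B_add_left[of u "- u'" v] by (simp add: B_uminus_left)

lemma B_add: "v \<in> mspace M \<Longrightarrow> w \<in> mspace M \<Longrightarrow> B u (v + w) = B u v + B u w"
  by (simp add: B_def monomial_add lin_ext_fun_add)

lemma B_scaleC: "v \<in> mspace M \<Longrightarrow> B u (c *\<^sub>C v) = c *\<^sub>C B u v"
  by (simp add: B_def monomial_scaleC lin_ext_fun_scaleC)

lemma B_M: "v \<in> mspace M \<Longrightarrow> B u v \<in> mspace M"
  unfolding B_def lin_ext_def
  by (intro complex_vector.subspace_sum[OF csubspace_M] complex_vector.subspace_scale[OF csubspace_M] monomial_M)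

lemma B_part: "u \<in> ext_part i \<Longrightarrow> v \<in> part M j \<Longrightarrow> B u v \<in> part M (i + j)"
  unfolding ext_part_def
proof (induction rule: complex_vector.span_induct_alt)
  case base
  then show ?case using complex_vector.subspace_0[OF csubspace_part] by simp
next
  case (step c x y)
  then have "B x v \<in> part M (i + j)" using monomial_part by (auto simp only: B_basis)
  then show ?case using step
    by (simp add: B_add_left B_scaleC_left complex_vector.subspace_add[OF csubspace_part]
        complex_vector.subspace_scale[OF csubspace_part])
qed

lemma a_B:
  assumes v: "v \<in> Vac"
  shows "a n (B u v) = B (psi_op n u) v"
proof (induction u rule: ext_induct)
  case (basis S)
  show ?case
    by (cases n rule: mode_cases)
      (simp_all add: B_basis a_monomial[OF v] psi_op_annihilation psi_op_creation B_scaleC_left)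
qed (use v in \<open>simp_all add: B_add_left B_scaleC_left psi_op_add psi_op_scaleC a_add a_scaleC B_M Vac_M
    complex_vector.subspace_scale[OF csubspace_M]\<close>)

lemma act_c_B: "v \<in> mspace M \<Longrightarrow> act M \<c> (B u v) = B u (act M \<c> v)"
  by (induction u rule: ext_induct)
    (simp_all add: B_basis act_c_monomial B_add_left B_scaleC_left act_0 act_add act_scaleC B_M
      complex_vector.subspace_scale[OF csubspace_M])

section \<open>The defect operators \<open>ell\<close>\<close>

lemma ell_Vac:
  assumes v: "v \<in> Vac"
  shows "ell k v \<in> Vac"
proof -
  have M: "act M (L k) v \<in> mspace M" "B u v \<in> mspace M" for u
    using v by (simp_all add: Vac_M act_M_basis B_M)
  have "a n (ell k v) = 0" if n: "n \<ge> 0" for n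
  proof -
    have "a n (act M (L k) v) = (half n + of_int k / 2) *\<^sub>C a (n + k) v"
      using act_L_a[OF Vac_M[OF v], of k n] a_Vac[OF v n] by (simp add: act_0)
    moreover have "psi_op n (L_op k vac) = (half n + of_int k / 2) *\<^sub>C psi_op (n + k) vac"
      using L_op_psi_op[of k n vac] psi_op_vac[OF n] by simp
    moreover have "B (psi_op (n + k) vac) v = a (n + k) v"
      using a_B[OF v, of "n + k" vac] by (simp add: B_basis)
    ultimately show ?thesis
      by (simp add: ell_def a_diff M a_B v B_scaleC_left)
  qed
  then show ?thesis using M complex_vector.subspace_diff[OF csubspace_M]
    by (simp add: Vac_def ell_def)
qed

lemma vac_part: "vac \<in> ext_part 0"
  unfolding ext_part_def by (rule complex_vector.span_base) (auto simp: fcard_fempty intro!: exI[of _ "{||}"])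

lemma ell_part: "v \<in> Vac_part i \<Longrightarrow> ell k v \<in> Vac_part i"
proof -
  assume v: "v \<in> Vac_part i"
  have "act M (L k) v \<in> part M i" "B (L_op k vac) v \<in> part M i"
    using act_part[OF Vac_part_M[OF v], of "gL k"] B_part[OF L_op_part[OF vac_part] Vac_part_M[OF v]]
    by (simp_all only: fv_parity.simps add_0_left)
  then have "ell k v \<in> part M i"
    unfolding ell_def by (rule complex_vector.subspace_diff[OF csubspace_part])
  then show ?thesis
    using ell_Vac[OF Vac_part_Vac[OF v]] by (simp add: Vac_def Vac_part_def)
qed

text \<open>On \<open>vac\<close> this is the definition of \<open>ell\<close>, and each further
  mode adds the same commutator on both sides.\<close>

lemma act_L_B:
  assumes v: "v \<in> Vac"
  shows "act M (L k) (B u v) = B (L_op k u) v + B u (ell k v)"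
proof (induction u rule: fock_induct)
  case (psi n u)
  have M: "B u w \<in> mspace M" "B u (ell k v) \<in> mspace M" if "w \<in> Vac" for w u
    using that v ell_Vac by (simp_all add: Vac_M B_M)
  have "act M (L k) (B (psi_op n u) v) = act M (L k) (a n (B u v))" by (simp add: a_B v)
  also have "\<dots> = a n (act M (L k) (B u v)) - (half n + of_int k / 2) *\<^sub>C a (n + k) (B u v)"
    using v M by (intro act_L_a) blast
  also have "\<dots> = B (psi_op n (L_op k u) - (half n + of_int k / 2) *\<^sub>C psi_op (n + k) u) v
      + B (psi_op n u) (ell k v)"
    using v ell_Vac[OF v] M[OF v] by (simp add: psi a_B a_add B_diff_left B_scaleC_left)
  finally show ?case by (simp add: L_op_psi_op)
next
  case (add c u u')
  have "B w v \<in> mspace M" for w using v by (simp add: Vac_M B_M)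
  then show ?case using add
    by (simp add: B_add_left B_scaleC_left act_add act_scaleC L_op_add L_op_scaleC
        complex_vector.subspace_scale[OF csubspace_M] complex_vector.scale_right_distrib algebra_simps)
qed (simp_all add: act_0 B_basis ell_def)

lemma ell_add: "v \<in> mspace M \<Longrightarrow> w \<in> mspace M \<Longrightarrow> ell k (v + w) = ell k v + ell k w"
  by (simp add: ell_def act_add B_add)

lemma ell_scaleC: "v \<in> mspace M \<Longrightarrow> ell k (c *\<^sub>C v) = c *\<^sub>C ell k v"
  by (simp add: ell_def act_scaleC B_scaleC complex_vector.scale_right_diff_distrib)

lemma ell_commutator:
  assumes v: "v \<in> Vac"
  shows "ell m (ell n v) - ell n (ell m v) = of_int (m - n) *\<^sub>C ell (m + n) v
    + (if m = - n then of_int (m ^ 3 - m) / 12 else 0) *\<^sub>C (act M \<c> v - (1 / 2) *\<^sub>C v)"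
proof -
  have M: "v \<in> mspace M" "ell k v \<in> mspace M" "B u v \<in> mspace M" for k u
    using v ell_Vac[OF v] by (simp_all add: Vac_M B_M)
  have L: "act M (L k) w = B (L_op k vac) w + ell k w" for k w by (simp add: ell_def)
  \<comment> \<open>The two mixed terms are exchanged by swapping \<open>m\<close> and
    \<open>n\<close>, so they drop out of the commutator.\<close>
  have LL: "act M (L m) (act M (L n) v) = B (L_op m (L_op n vac)) v + B (L_op n vac) (ell m v)
      + B (L_op m vac) (ell n v) + ell m (ell n v)" for m n
    by (simp add: L[of n v] act_add M act_L_B[OF v] L[of m "ell n v"])
  have "act M (L m) (act M (L n) v) - act M (L n) (act M (L m) v)
      = act M (fv_gen_bracket (gL m) (gL n)) v"
    using act_bracket[OF M(1), of "gL m" "gL n"] by (simp add: koszul_def del: fv_gen_bracket.simps)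
  also have "\<dots> = of_int (m - n) *\<^sub>C (B (L_op (m + n) vac) v + ell (m + n) v)
      + (if m = - n then of_int (m ^ 3 - m) / 12 else 0) *\<^sub>C act M \<c> v"
    using M(1) by (simp add: act_add_left act_scaleC_left act_0_left L)
  also have "act M (L m) (act M (L n) v) - act M (L n) (act M (L m) v) =
      B (L_op m (L_op n vac) - L_op n (L_op m vac)) v + (ell m (ell n v) - ell n (ell m v))"
    by (simp add: LL B_diff_left)
  also have "B (L_op m (L_op n vac) - L_op n (L_op m vac)) v =
      of_int (m - n) *\<^sub>C B (L_op (m + n) vac) v + (if m = - n then of_int (m ^ 3 - m) / 24 else 0) *\<^sub>C v"
    unfolding L_op_commutator_vac by (simp add: B_add_left B_scaleC_left B_basis)
  finally have "of_int (m - n) *\<^sub>C B (L_op (m + n) vac) v + (if m = - n then of_int (m ^ 3 - m) / 24 else 0) *\<^sub>C v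
      + (ell m (ell n v) - ell n (ell m v))
    = of_int (m - n) *\<^sub>C (B (L_op (m + n) vac) v + ell (m + n) v)
      + (if m = - n then of_int (m ^ 3 - m) / 12 else 0) *\<^sub>C act M \<c> v" .
  \<comment> \<open>Rewriting the central term of the Fock vacuum over the denominator 12 is what
    turns \<open>\<c>\<close> into \<open>\<c>\<close> minus 1/2.\<close>
  moreover have "(if m = - n then of_int (m ^ 3 - m) / 24 else 0) *\<^sub>C v =
     (if m = - n then of_int (m ^ 3 - m) / 12 else 0) *\<^sub>C ((1 / 2) *\<^sub>C v)" by simp
  ultimately show ?thesis
    by (simp only: complex_vector.scale_right_distrib complex_vector.scale_right_diff_distrib) (simp add: algebra_simps)
qed

end

section \<open>Spans of bilinear images, for \<open>B\<close> and the tensor product alike\<close>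

lemma whole_ext_part: "whole ext_part = UNIV"
proof -
  have "u \<in> cspan ({basis_vec S | S. of_nat (fcard S) = (0::bit)} \<union> {basis_vec S | S. of_nat (fcard S) = (1::bit)})"
    for u :: ext
  proof -
    have "basis_vec S \<in> {basis_vec S | S. of_nat (fcard S) = (0::bit)} \<union> {basis_vec S | S. of_nat (fcard S) = (1::bit)}"
      for S :: "nat fset"
      by (cases "of_nat (fcard S) :: bit") blast+
    then have "range (basis_vec :: nat fset \<Rightarrow> ext) \<subseteq> {basis_vec S | S. of_nat (fcard S) = (0::bit)} \<union> {basis_vec S | S. of_nat (fcard S) = (1::bit)}"
      by blast
    then show ?thesis using fv_span[of u] complex_vector.span_mono by blast
  qed
  then show ?thesis
    unfolding whole_def ext_part_def complex_vector.span_Un by blast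
qed

text \<open>The second argument is restricted to \<open>X\<close> because the action on
  \<open>M\<close>, and with it \<open>B\<close>, is known to be linear only on
  \<open>mspace M\<close>.\<close>

definition bilinear_on :: "'m::complex_vector set \<Rightarrow> (ext \<Rightarrow> 'm \<Rightarrow> 'c::complex_vector) \<Rightarrow> bool" where
  "bilinear_on X b \<longleftrightarrow> (\<forall>v\<in>X. clinear (\<lambda>u. b u v)) \<and> (\<forall>u. clinear_on X (b u))"

lemma clinearI:
  assumes "\<And>x y. f (x + y) = f x + f y" "\<And>c x. f (c *\<^sub>C x) = c *\<^sub>C f x"
  shows "clinear f"
  by unfold_locales (use assms in auto)

lemma bilinear_on_simps:
  assumes "bilinear_on X b" "v \<in> X"
  shows "b (u + u') v = b u v + b u' v" "b (c *\<^sub>C u) v = c *\<^sub>C b u v"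
    "b u (c *\<^sub>C v) = c *\<^sub>C b u v" "w \<in> X \<Longrightarrow> b u (v + w) = b u v + b u w"
    "b (\<Sum>i\<in>A. g i) v = (\<Sum>i\<in>A. b (g i) v)"
proof -
  interpret Vector_Spaces.linear scaleC scaleC "\<lambda>u. b u v"
    using assms by (simp add: bilinear_on_def)
  show "b (u + u') v = b u v + b u' v" "b (c *\<^sub>C u) v = c *\<^sub>C b u v"
    "b (\<Sum>i\<in>A. g i) v = (\<Sum>i\<in>A. b (g i) v)"
    by (rule add scale sum)+
  show "b u (c *\<^sub>C v) = c *\<^sub>C b u v" "w \<in> X \<Longrightarrow> b u (v + w) = b u v + b u w"
    using assms by (auto simp: bilinear_on_def clinear_on_def)
qed

text \<open>Splitting both arguments into homogeneous components shows that the graded pieces span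
  everything.\<close>

lemma span_bilinear_graded:
  assumes N: "csubspace (N 0)" "csubspace (N 1)" and b: "bilinear_on (whole N) b"
  shows "whole (\<lambda>k. cspan {b u v | u v i j. u \<in> ext_part i \<and> v \<in> N j \<and> i + j = k}) =
    cspan {b u v | u v. v \<in> whole N}" (is "whole (\<lambda>k. cspan (?A k)) = cspan ?C")
proof -
  have sub: "N j \<subseteq> whole N" for j using part_whole[OF N] .
  have "cspan (?A 0 \<union> ?A 1) = cspan ?C"
  proof (rule antisym; rule complex_vector.span_minimal)
    show "?A 0 \<union> ?A 1 \<subseteq> cspan ?C" using sub by (auto intro!: complex_vector.span_base)
    show "?C \<subseteq> cspan (?A 0 \<union> ?A 1)"
    proof
      fix t assume "t \<in> ?C"
      then obtain u v where t: "t = b u v" "v \<in> whole N" by blast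
      obtain u0 u1 where u: "u = u0 + u1" "u0 \<in> ext_part 0" "u1 \<in> ext_part 1"
        using whole_ext_part unfolding whole_def by blast
      obtain v0 v1 where v: "v = v0 + v1" "v0 \<in> N 0" "v1 \<in> N 1"
        using t(2) unfolding whole_def by blast
      have "b u v = b u0 v0 + b u0 v1 + b u1 v0 + b u1 v1"
        using u v sub bilinear_on_simps[OF b] t(2) by (simp add: subset_iff)
      moreover have "b u' v' \<in> cspan (?A 0 \<union> ?A 1)" if "u' \<in> ext_part i" "v' \<in> N j" for u' v' i j
        using that by (intro complex_vector.span_base) (cases "i + j"; blast)
      ultimately show "t \<in> cspan (?A 0 \<union> ?A 1)"
        using t u v by (simp add: complex_vector.span_add)
    qed
  qed (rule complex_vector.subspace_span)+
  then show ?thesis unfolding whole_def complex_vector.span_Un by blast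
qed

text \<open>The first argument is expanded over the basis monomials and the coefficients are
  collected in the second argument, one vector for each \<open>S\<close>. Letting \<open>f\<close>
  be 0 outside \<open>F\<close> allows \<open>F\<close> to be enlarged at will.\<close>

lemma span_bilinear_decomposition:
  assumes X: "csubspace X" and b: "bilinear_on X b" and t: "t \<in> cspan {b u v | u v. v \<in> X}"
  obtains f F where "finite F" "\<And>S. f S \<in> X" "\<And>S. S \<notin> F \<Longrightarrow> f S = 0"
    "t = (\<Sum>S\<in>F. b (basis_vec S) (f S))"
proof -
  have "\<exists>f F. finite F \<and> (\<forall>S. f S \<in> X) \<and> (\<forall>S. S \<notin> F \<longrightarrow> f S = 0) \<and>
      t = (\<Sum>S\<in>F. b (basis_vec S) (f S))"
    using t
  proof (induction rule: complex_vector.span_induct_alt)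
    case base
    then show ?case
      by (intro exI[of _ "\<lambda>_. 0"] exI[of _ "{}"]) (simp add: complex_vector.subspace_0[OF X])
  next
    case (step c x y)
    then obtain u v where x: "x = b u v" "v \<in> X" by blast
    from step obtain f F where F: "finite F" "\<And>S. f S \<in> X" "\<And>S. S \<notin> F \<Longrightarrow> f S = 0"
      "y = (\<Sum>S\<in>F. b (basis_vec S) (f S))" by blast
    let ?F = "Poly_Mapping.keys u \<union> F"
    let ?g = "\<lambda>S. (c * Poly_Mapping.lookup u S) *\<^sub>C v + f S"
    have scaled: "z *\<^sub>C v \<in> X" for z using x(2) by (rule complex_vector.subspace_scale[OF X])
    have zero: "b w 0 = 0" for w using bilinear_on_simps(3)[OF b x(2), of w 0] by simp
    have "u = (\<Sum>S\<in>?F. Poly_Mapping.lookup u S *\<^sub>C basis_vec S)"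
      using F(1) lin_ext_superset[of ?F u basis_vec] by (simp add: fv_expand)
    then have "b u v = b (\<Sum>S\<in>?F. Poly_Mapping.lookup u S *\<^sub>C basis_vec S) v" by simp
    also have "\<dots> = (\<Sum>S\<in>?F. Poly_Mapping.lookup u S *\<^sub>C b (basis_vec S) v)"
      by (simp only: bilinear_on_simps[OF b x(2)])
    finally have "c *\<^sub>C x = (\<Sum>S\<in>?F. b (basis_vec S) ((c * Poly_Mapping.lookup u S) *\<^sub>C v))"
      by (simp only: x bilinear_on_simps[OF b x(2)] complex_vector.scale_sum_right scaleC_scaleC)
    moreover have "y = (\<Sum>S\<in>?F. b (basis_vec S) (f S))"
      unfolding F(4) by (rule sum.mono_neutral_left) (use F in \<open>auto simp: zero\<close>)
    ultimately have "c *\<^sub>C x + y = (\<Sum>S\<in>?F. b (basis_vec S) (?g S))"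
      by (simp only: bilinear_on_simps(4)[OF b scaled F(2)] sum.distrib)
    moreover have "?g S \<in> X" for S using complex_vector.subspace_add[OF X scaled F(2)] .
    moreover have "?g S = 0" if "S \<notin> ?F" for S using that F(3) by (simp add: in_keys_iff)
    ultimately show ?case
      using F(1) by (intro exI[of _ ?g] exI[of _ ?F] conjI allI impI) auto
  qed
  then show ?thesis using that by blast
qed

text \<open>As the sum of \<open>P 0\<close> and \<open>P 1\<close> is direct, the component of the
  other parity of a homogeneous vector vanishes.\<close>

lemma graded_part_eq:
  assumes "superspace P" "\<And>i. csubspace (Q i)" "\<And>i. Q i \<subseteq> P i" "whole Q = whole P"
  shows "Q i = P i"
proof
  show "P i \<subseteq> Q i"
  proof
    fix v assume v: "v \<in> P i"
    have P: "csubspace (P j)" "P 0 \<inter> P 1 = {0}" for j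
      using assms(1) by (cases j; simp add: superspace_def)+
    from v have "v \<in> whole Q" using part_whole[of P i] P assms(4) by blast
    then obtain x y where xy: "v = x + y" "x \<in> Q 0" "y \<in> Q 1" by (auto simp: whole_def)
    then have xyP: "x \<in> P 0" "y \<in> P 1" using assms(3) by blast+
    show "v \<in> Q i"
    proof (cases i)
      case zero
      then have "y \<in> P 0" using complex_vector.subspace_diff[OF P(1)[of 0], of v x] v xy(1) xyP by simp
      then have "y = 0" using P xyP by blast
      then show ?thesis using xy zero by simp
    next
      case one
      then have "x \<in> P 1" using complex_vector.subspace_diff[OF P(1)[of 1], of v y] v xy(1) xyP by simp
      then have "x = 0" using P xyP by blast
      then show ?thesis using xy one by simp
    qed
  qed
qed (rule assms)

context level_module
begin

section \<open>The Virasoro module \<open>V\<close>\<close>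

lemma act_V_basis:
  "act V (basis_vec b) v = (case b of gL k \<Rightarrow> ell k v | gC \<Rightarrow> act M \<c> v - (1 / 2) *\<^sub>C v | _ \<Rightarrow> 0)"
  and act_V_add_left: "act V (x + y) v = act V x v + act V y v"
  and act_V_scaleC_left: "act V (c *\<^sub>C x) v = c *\<^sub>C act V x v"
  and act_V_0_left [simp]: "act V 0 v = 0"
  by (simp_all add: V_def lin_ext_add lin_ext_scaleC)

lemma part_V: "part V = Vac_part" by (simp add: V_def)

lemma act_c_Vac_part: "v \<in> Vac_part i \<Longrightarrow> act M \<c> v \<in> Vac_part i"
  using act_part[of v i gC]
  by (auto simp: Vac_part_def part_M act_0 act_c_a[symmetric] simp del: add_bit_eq_xor)

lemma act_V_part: "v \<in> Vac_part i \<Longrightarrow> act V x v \<in> Vac_part i"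
proof (induction x rule: ext_induct)
  case (basis b)
  then show ?case
    by (cases b) (simp_all add: act_V_basis ell_part complex_vector.subspace_0[OF csubspace_Vac_part]
        complex_vector.subspace_diff[OF csubspace_Vac_part] act_c_Vac_part complex_vector.subspace_scale[OF csubspace_Vac_part])
qed (simp_all add: act_V_add_left act_V_scaleC_left complex_vector.subspace_0[OF csubspace_Vac_part]
    complex_vector.subspace_add[OF csubspace_Vac_part] complex_vector.subspace_scale[OF csubspace_Vac_part])

lemma act_V_add: "v \<in> Vac \<Longrightarrow> w \<in> Vac \<Longrightarrow> act V x (v + w) = act V x v + act V x w"
proof (induction x rule: ext_induct)
  case (basis b)
  then show ?case
    by (cases b) (simp_all add: act_V_basis Vac_M ell_add act_add complex_vector.scale_right_distrib)
qed (simp_all add: act_V_add_left act_V_scaleC_left complex_vector.scale_right_distrib)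

lemma act_V_scaleC: "v \<in> Vac \<Longrightarrow> act V x (c *\<^sub>C v) = c *\<^sub>C act V x v"
proof (induction x rule: ext_induct)
  case (basis b)
  then show ?case
    by (cases b) (simp_all add: act_V_basis Vac_M ell_scaleC act_scaleC complex_vector.scale_right_diff_distrib mult.commute)
qed (simp_all add: act_V_add_left act_V_scaleC_left complex_vector.scale_right_distrib mult.commute)

lemma csubspace_V: "csubspace (mspace V)"
  by (simp add: part_V csubspace_whole csubspace_Vac_part)

lemma mspace_V: "mspace V \<subseteq> Vac"
  using whole_Vac_part by (auto simp: part_V)

lemma act_V_V: "v \<in> mspace V \<Longrightarrow> act V x v \<in> mspace V"
  unfolding part_V whole_def by (force simp: act_V_add Vac_part_Vac intro: act_V_part)

text \<open>Bilinearity reduces the relation to generators. It is stated on all of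
  \<open>fv_part 0\<close>, where \<open>\<z>\<close> acts as 0, so that
  \<open>fv_part_induct2\<close> applies.\<close>

lemma act_V_bracket:
  assumes x: "x \<in> fv_part 0" and y: "y \<in> fv_part 0" and v: "v \<in> mspace V"
  shows "act V (fv_bracket x y) v = act V x (act V y v) - act V y (act V x v)"
proof -
  have V: "act V x v \<in> Vac" for x using act_V_V[OF v] mspace_V by blast
  have "v \<in> Vac" using v mspace_V by blast
  then have vM: "v \<in> mspace M" "ell k v \<in> mspace M" for k by (simp_all add: Vac_M ell_Vac)
  have c_ell: "act M \<c> (ell k v) = ell k (act M \<c> v)" for k
    by (simp add: ell_def act_diff vM act_M_basis B_M act_c_commute[symmetric] act_c_B)
  have ell_diff: "ell k (act M \<c> v - c *\<^sub>C v) = ell k (act M \<c> v) - c *\<^sub>C ell k v" for k c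
    using ell_add[of "act M \<c> v" "(- c) *\<^sub>C v" k] ell_scaleC[of v k "- c"] vM
    by (simp add: act_M_basis complex_vector.subspace_neg[OF csubspace_M] complex_vector.subspace_scale[OF csubspace_M])
  show ?thesis
    using x y
  proof (rule fv_part_induct2[where P = "\<lambda>x y. act V (fv_bracket x y) v = act V x (act V y v) - act V y (act V x v)"])
    fix a b assume ab: "fv_parity a = 0" "fv_parity b = 0"
    have "ell m (ell n v) - ell n (ell m v) = act V (fv_gen_bracket (gL m) (gL n)) v" for m n
      using ell_commutator[OF \<open>v \<in> Vac\<close>, of m n]
      by (simp add: act_V_add_left act_V_scaleC_left act_V_basis)
    then show "act V (fv_bracket (basis_vec a) (basis_vec b)) v =
      act V (basis_vec a) (act V (basis_vec b) v) - act V (basis_vec b) (act V (basis_vec a) v)"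
      using ab by (cases a; cases b)
        (simp_all del: fv_gen_bracket.simps(1) add: fv_bracket_basis act_V_basis act_0 ell_diff c_ell
          ell_scaleC[of 0 _ 0, simplified] complex_vector.subspace_0[OF csubspace_M])
  qed (simp_all add: fv_bracket_add fv_bracket_scaleC act_V_add_left act_V_scaleC_left V act_V_add act_V_scaleC
      complex_vector.subspace_scale[OF csubspace_Vac] add_diff_add complex_vector.scale_right_diff_distrib
      act_V_scaleC[of 0 _ 0, simplified] complex_vector.subspace_0[OF csubspace_Vac])
qed

lemma gpart_Vir_0: "gpart Vir 0 \<subseteq> fv_part 0"
proof -
  have "fv_parity gC = 0" "fv_parity (gL m) = 0" for m by simp_all
  then have "insert \<c> (range (\<lambda>m. L m)) \<subseteq> {basis_vec b | b. fv_parity b = 0}" by blast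
  then show ?thesis by (simp add: Vir_def complex_vector.span_mono)
qed

lemma gpart_Vir_1: "gpart Vir 1 = {0}"
  by (simp add: Vir_def)

lemma is_module_V: "is_module Vir V"
  unfolding is_module_def
proof (intro conjI allI ballI)
  show "superspace (part V)"
    using superspace complex_vector.subspace_0[OF csubspace_Vac_part] csubspace_Vac_part
    unfolding superspace_def part_V by (auto simp: Vac_part_def)
  show "clinear_on (mspace V) (act V x)" for x
    using mspace_V act_V_add act_V_scaleC unfolding clinear_on_def by blast
  show "clinear_on (whole (gpart Vir)) (\<lambda>x. act V x v)" for v
    by (simp add: clinear_on_def act_V_add_left act_V_scaleC_left)
  show "act V x v \<in> part V (i + j)" if x: "x \<in> gpart Vir i" and v: "v \<in> part V j" for i j x v
  proof (cases i)
    case zero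
    then show ?thesis using v by (simp only: part_V act_V_part add_0_left)
  next
    case one
    then show ?thesis using x gpart_Vir_1 complex_vector.subspace_0[OF csubspace_Vac_part] by (simp add: part_V)
  qed
  show "act V (bracket Vir x y) v = act V x (act V y v) - koszul i j *\<^sub>C act V y (act V x v)"
    if x: "x \<in> gpart Vir i" and y: "y \<in> gpart Vir j" and v: "v \<in> mspace V" for i j x y v
  proof -
    have zero: "act V x 0 = 0" for x
      using act_V_scaleC[of 0 x 0] complex_vector.subspace_0[OF csubspace_Vac] by simp
    have "x = 0 \<or> i = 0 \<and> x \<in> fv_part 0" "y = 0 \<or> j = 0 \<and> y \<in> fv_part 0"
      using x y gpart_Vir_0 gpart_Vir_1 by (cases i; cases j; auto)+
    then show ?thesis
      using act_V_bracket[OF _ _ v, of x y] by (auto simp: Vir_def koszul_def zero)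
  qed
qed

text \<open>For \<open>i \<ge> 0\<close> the operator \<open>L_op i\<close> kills
  \<open>vac\<close>, so \<open>ell i\<close> agrees with the action of L_i on
  \<open>M\<close>.\<close>

lemma smooth_V:
  assumes "smooth_FV M"
  shows "smooth_Vir V"
  unfolding smooth_Vir_def
proof
  fix v assume v: "v \<in> mspace V"
  then have "v \<in> mspace M" using mspace_V Vac_M by blast
  then obtain n where n: "\<forall>i>int n. act M (L i) v = 0" using assms unfolding smooth_FV_def by blast
  then show "\<exists>n. \<forall>i>int n. act V (L i) v = 0"
    by (intro exI[of _ n]) (simp add: act_V_basis ell_def L_op_vac_nonneg)
qed

section \<open>Independence of creation monomials\<close>

lemma a_sum: "(\<And>i. i \<in> A \<Longrightarrow> f i \<in> mspace M) \<Longrightarrow> a n (\<Sum>i\<in>A. f i) = (\<Sum>i\<in>A. a n (f i))"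
  by (induction A rule: infinite_finite_induct)
    (simp_all add: a_add complex_vector.subspace_sum[OF csubspace_M])

text \<open>Induction on the ambient set: annihilating the new index \<open>n\<close> kills the
  monomials without \<open>n\<close> and turns the others into monomials over \<open>U\<close>.
  Hence the coefficients of sets containing \<open>n\<close> vanish first, and the remaining sum
  runs over subsets of \<open>U\<close>.\<close>

lemma monomial_independent_fPow:
  assumes "\<And>S. f S \<in> Vac" "(\<Sum>S\<in>fset (fPow U). monomial S (f S)) = 0" "S |\<subseteq>| U"
  shows "f S = 0"
  using assms
proof (induction U arbitrary: f S rule: fset_induct_stronger)
  case (insert n U)
  have n: "n |\<notin>| T" if "T |\<subseteq>| U" for T using that insert.hyps by auto
  have M: "monomial T (f T') \<in> mspace M" for T T' using insert.prems by (simp add: monomial_M Vac_M)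
  have disj: "fset (fPow U) \<inter> finsert n ` fset (fPow U) = {}" using insert.hyps by auto
  have inj: "inj_on (finsert n) (fset (fPow U))"
  proof (rule inj_onI)
    fix S T assume "S \<in> fset (fPow U)" "T \<in> fset (fPow U)" "finsert n S = finsert n T"
    then show "S = T" using n by (metis fPow_iff finsert_ident)
  qed
  have "fset (fPow (finsert n U)) = fset (fPow U) \<union> finsert n ` fset (fPow U)"
    by (simp add: fPow_finsert)
  then have split: "(\<Sum>S\<in>fset (fPow U). monomial S (f S))
      + (\<Sum>S\<in>fset (fPow U). monomial (finsert n S) (f (finsert n S))) = 0"
    using insert.prems(2) disj inj by (simp add: sum.union_disjoint sum.reindex)
  have "0 = a (int n) ((\<Sum>S\<in>fset (fPow U). monomial S (f S))
      + (\<Sum>S\<in>fset (fPow U). monomial (finsert n S) (f (finsert n S))))"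
    unfolding split by simp
  also have "\<dots> = (\<Sum>S\<in>fset (fPow U). a (int n) (monomial S (f S)))
      + (\<Sum>S\<in>fset (fPow U). a (int n) (monomial (finsert n S) (f (finsert n S))))"
    by (simp add: a_add a_sum M complex_vector.subspace_sum[OF csubspace_M])
  also have "(\<Sum>S\<in>fset (fPow U). a (int n) (monomial S (f S))) = 0"
    using n by (intro sum.neutral) (auto simp: a_monomial insert.prems(1))
  also have "(\<Sum>S\<in>fset (fPow U). a (int n) (monomial (finsert n S) (f (finsert n S)))) =
      (\<Sum>S\<in>fset (fPow U). monomial S (below_sign n S *\<^sub>C f (finsert n S)))"
  proof (rule sum.cong[OF refl])
    fix S assume "S \<in> fset (fPow U)"
    then have "finsert n S |-| {|n|} = S" using n by auto
    then show "a (int n) (monomial (finsert n S) (f (finsert n S))) = monomial S (below_sign n S *\<^sub>C f (finsert n S))"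
      using insert.prems(1) by (simp add: a_monomial monomial_scaleC Vac_M)
  qed
  finally have "(\<Sum>S\<in>fset (fPow U). monomial S (below_sign n S *\<^sub>C f (finsert n S))) = 0" by simp
  then have "below_sign n T *\<^sub>C f (finsert n T) = 0" if "T |\<subseteq>| U" for T
    using that insert.prems(1)
    by (intro insert.IH[of "\<lambda>S. below_sign n S *\<^sub>C f (finsert n S)"])
      (auto intro: complex_vector.subspace_scale[OF csubspace_Vac])
  then have with_n: "f (finsert n T) = 0" if "T |\<subseteq>| U" for T
    using that by (simp add: below_sign_def)
  have "(\<Sum>S\<in>fset (fPow U). monomial (finsert n S) (f (finsert n S))) = 0"
    using with_n by (intro sum.neutral) auto
  then have "(\<Sum>S\<in>fset (fPow U). monomial S (f S)) = 0" using split by simp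
  then have without_n: "f T = 0" if "T |\<subseteq>| U" for T
    using that insert.prems(1) insert.IH by blast
  have "S |-| {|n|} |\<subseteq>| U" using insert.prems(3) by auto
  then show ?case
    using with_n[of "S |-| {|n|}"] without_n[of "S |-| {|n|}"]
    by (cases "n |\<in>| S") (auto simp: finsert_absorb)
qed simp

lemma monomial_independent:
  assumes "finite F" "\<And>S. f S \<in> Vac" "\<And>S. S \<notin> F \<Longrightarrow> f S = 0" "(\<Sum>S\<in>F. monomial S (f S)) = 0"
  shows "f S = 0"
proof (cases "S \<in> F")
  case True
  have "\<exists>U. \<forall>S\<in>F. S |\<subseteq>| U" using assms(1)
  proof induction
    case (insert T F)
    then obtain U where "\<forall>S\<in>F. S |\<subseteq>| U" by blast
    then show ?case by (intro exI[of _ "U |\<union>| T"]) auto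
  qed simp
  then obtain U where U: "\<forall>S\<in>F. S |\<subseteq>| U" by blast
  have "(\<Sum>S\<in>F. monomial S (f S)) = (\<Sum>S\<in>fset (fPow U). monomial S (f S))"
    by (rule sum.mono_neutral_left) (use U assms(3) in \<open>auto\<close>)
  then show ?thesis
    using monomial_independent_fPow[of f U S] assms U True by simp
qed (rule assms(3))

section \<open>Submodules of \<open>M\<close> generated by submodules of \<open>V\<close>\<close>

lemma bilinear_on_B: "X \<subseteq> mspace M \<Longrightarrow> bilinear_on X B"
  unfolding bilinear_on_def
  by (auto intro!: clinearI simp: clinear_on_def B_add_left B_scaleC_left B_add B_scaleC subset_iff)

text \<open>Recovers \<open>X\<close> from the space it generates: by independence the coefficient
  of the empty monomial must be \<open>v\<close> itself, and this coefficient lies in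
  \<open>X\<close>.\<close>

lemma Vac_decomposition:
  assumes X: "csubspace X" "X \<subseteq> Vac" and v: "v \<in> Vac" "v \<in> cspan {B u v | u v. v \<in> X}"
  shows "v \<in> X"
proof -
  have "X \<subseteq> mspace M" using X(2) Vac_M by blast
  then obtain f F where F: "finite F" "\<And>S. f S \<in> X" "\<And>S. S \<notin> F \<Longrightarrow> f S = 0"
    "v = (\<Sum>S\<in>F. B (basis_vec S) (f S))"
    using span_bilinear_decomposition[OF X(1) bilinear_on_B v(2)] by blast
  \<comment> \<open>Moving \<open>v\<close> to the other side turns the expansion into a vanishing
    sum; \<open>{||}\<close> is added to \<open>F\<close> so that its coefficient occurs.\<close>
  let ?F = "insert {||} F" and ?g = "\<lambda>S. if S = {||} then f S - v else f S"
  have v_eq: "v = (\<Sum>S\<in>?F. monomial S (f S))"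
    unfolding F(4) B_basis by (rule sum.mono_neutral_left) (use F in auto)
  have "(\<Sum>S\<in>?F. monomial S (?g S)) = (\<Sum>S\<in>?F. monomial S (f S) - (if S = {||} then v else 0))"
    by (rule sum.cong) auto
  also have "\<dots> = 0"
    using F(1) by (simp only: sum_subtractf v_eq[symmetric]) (simp add: sum.delta')
  finally have sum0: "(\<Sum>S\<in>?F. monomial S (?g S)) = 0" .
  have "f S \<in> Vac" for S using F(2) X(2) by blast
  then have "?g S \<in> Vac" for S
    using complex_vector.subspace_diff[OF csubspace_Vac _ v(1)] by simp
  moreover have "finite ?F" "\<And>S. S \<notin> ?F \<Longrightarrow> ?g S = 0" using F(1,3) by auto
  ultimately have "?g {||} = 0"
    using monomial_independent[of ?F ?g, OF _ _ _ sum0] by blast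
  then show ?thesis using F(2)[of "{||}"] by simp
qed

text \<open>Each generator is followed through \<open>B\<close>: L_k acts by \<open>L_op\<close> on
  the left and by \<open>ell\<close> on the right, the modes act on the left, \<open>\<c>\<close> on
  the right, and \<open>\<z>\<close> is a scalar.\<close>

lemma graded_submodule_span:
  assumes N: "graded_submodule Vir V N"
  shows "graded_submodule FV M (\<lambda>k. cspan {B u v | u v i j. u \<in> ext_part i \<and> v \<in> N j \<and> i + j = k})"
    and "whole (\<lambda>k. cspan {B u v | u v i j. u \<in> ext_part i \<and> v \<in> N j \<and> i + j = k})
      = cspan {B u v | u v. v \<in> whole N}"
proof -
  have N_part: "csubspace (N i)" "N i \<subseteq> Vac_part i" for i
    using N by (simp_all add: graded_submodule_def part_V)
  have N_sub: "csubspace (whole N)" by (simp add: N_part csubspace_whole)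
  have N_Vac: "v \<in> Vac" if "v \<in> whole N" for v
    using that N_part(2) Vac_part_Vac complex_vector.subspace_add[OF csubspace_Vac] unfolding whole_def by blast
  have N_act: "act V x v \<in> whole N" if "x \<in> gpart Vir 0" "v \<in> whole N" for x v
  proof -
    have "x \<in> whole (gpart Vir)"
      using that(1) complex_vector.span_zero by (force simp: whole_def Vir_def)
    then show ?thesis using N that(2) unfolding graded_submodule_def by blast
  qed
  let ?C = "cspan {B u v | u v. v \<in> whole N}"
  show whole: "whole (\<lambda>k. cspan {B u v | u v i j. u \<in> ext_part i \<and> v \<in> N j \<and> i + j = k}) = ?C"
    using N_Vac Vac_M by (intro span_bilinear_graded N_part bilinear_on_B) blast
  have C: "B u v \<in> ?C" if "v \<in> whole N" for u v using that by (intro complex_vector.span_base) blast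
  have C_M: "?C \<subseteq> mspace M"
    using N_Vac Vac_M B_M by (intro complex_vector.span_minimal csubspace_M) blast
  \<comment> \<open>Membership in \<open>mspace M\<close> is carried along because additivity of the
    action is available only there.\<close>
  have basis: "act M (basis_vec b) t \<in> ?C \<and> t \<in> mspace M" if "t \<in> ?C" for b t
    using that
  proof (induction rule: complex_vector.span_induct_alt)
    case base
    then show ?case
      by (simp add: act_0 complex_vector.span_zero complex_vector.subspace_0[OF csubspace_M])
  next
    case (step c x y)
    then obtain u v where x: "x = B u v" "v \<in> whole N" by blast
    have v: "v \<in> Vac" using N_Vac x by blast
    have "act M (basis_vec b) (B u v) \<in> ?C"
    proof (cases b)
      case (gL k)
      have "ell k v \<in> whole N"
        using N_act[of "L k" v] x(2) by (simp add: act_V_basis Vir_def complex_vector.span_base)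
      then show ?thesis using x(2) by (simp add: gL act_L_B v C complex_vector.span_add)
    next
      case (gPsi n)
      have "act M (\<psi> n) (B u v) = \<mu> *\<^sub>C a n (B u v)" using mu by (simp add: a_def)
      then show ?thesis using x(2) by (simp add: gPsi a_B v C complex_vector.span_scale)
    next
      case gC
      have "act M \<c> v - (1 / 2) *\<^sub>C v \<in> whole N"
        using N_act[of \<c> v] x(2) by (simp add: act_V_basis Vir_def complex_vector.span_base)
      \<comment> \<open>Adding half of \<open>v\<close> undoes the shift of the central charge in
        \<open>V\<close>.\<close>
      then have "act M \<c> v \<in> whole N"
        using complex_vector.subspace_add[OF N_sub _ complex_vector.subspace_scale[OF N_sub x(2), of "1 / 2"]] by force
      then show ?thesis by (simp add: gC act_c_B Vac_M v C)
    next
      case gZ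
      then show ?thesis using level x(2) v
        by (simp add: has_level_def B_M Vac_M C complex_vector.span_scale)
    qed
    moreover have "B u v \<in> mspace M"
      using v by (simp add: B_M Vac_M)
    ultimately show ?case
      using step.IH x(1) by (simp add: act_add act_scaleC complex_vector.subspace_scale[OF csubspace_M]
          complex_vector.subspace_add[OF csubspace_M] complex_vector.span_add complex_vector.span_scale)
  qed
  have "act M x t \<in> ?C" if "t \<in> ?C" for x t
    using act_expand[of t x] that C_M basis unfolding lin_ext_def
    by (auto intro!: complex_vector.span_sum complex_vector.span_scale)
  moreover have "cspan {B u v | u v i j. u \<in> ext_part i \<and> v \<in> N j \<and> i + j = k} \<subseteq> part M k" for k
    using N_part(2) B_part Vac_part_M
    by (intro complex_vector.span_minimal csubspace_part) blast
  ultimately show "graded_submodule FV M (\<lambda>k. cspan {B u v | u v i j. u \<in> ext_part i \<and> v \<in> N j \<and> i + j = k})"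
    unfolding graded_submodule_def whole by (simp add: complex_vector.subspace_span)
qed

text \<open>Induction on the number of annihilation modes that do not kill \<open>v\<close>. Passing
  to a nonzero \<open>a j v\<close> lowers it: the modes killing \<open>v\<close> also kill
  \<open>a j v\<close> by anticommutation, and \<open>a j\<close> squares to 0. Each step changes
  the parity, which is therefore existential in the conclusion.\<close>

lemma vacuum_vector_exists:
  assumes "v \<in> part M i" "v \<noteq> 0" "finite {j. j \<ge> 0 \<and> a j v \<noteq> 0}"
  shows "\<exists>i w. w \<in> Vac_part i \<and> w \<noteq> 0"
  using assms
proof (induction "card {j. j \<ge> 0 \<and> a j v \<noteq> 0}" arbitrary: v i rule: less_induct)
  case less
  show ?case
  proof (cases "{j. j \<ge> 0 \<and> a j v \<noteq> 0} = {}")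
    case True
    then show ?thesis using less.prems by (auto simp: Vac_part_def)
  next
    case False
    then obtain j where j: "j \<ge> 0" "a j v \<noteq> 0" by blast
    have v: "v \<in> mspace M" using less.prems part_M by blast
    have killed: "a k (a j v) = 0" if "k \<ge> 0" "a k v = 0" for k
      using a_anticommute[OF v, of k j] that j by simp
    have "a j (a j v) = 0" using v j by (intro a_square) auto
    then have sub: "{k. k \<ge> 0 \<and> a k (a j v) \<noteq> 0} \<subset> {k. k \<ge> 0 \<and> a k v \<noteq> 0}"
      using j killed by blast
    show ?thesis
      by (rule less.hyps[OF psubset_card_mono[OF less.prems(3) sub] a_part[OF less.prems(1)] j(2)
            finite_subset[OF psubset_imp_subset[OF sub] less.prems(3)]])
  qed
qed

lemma V_nonzero:
  assumes "smooth_FV M" "mspace M \<noteq> {0}"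
  shows "mspace V \<noteq> {0}"
proof -
  have "\<exists>i v. v \<in> part M i \<and> v \<noteq> 0"
  proof (rule ccontr)
    assume "\<not> ?thesis"
    then have "part M i = {0}" for i using complex_vector.subspace_0[OF csubspace_part[of i]] by auto
    then show False using assms(2) by (simp add: whole_def)
  qed
  then obtain i v where v: "v \<in> part M i" "v \<noteq> 0" by blast
  then obtain n :: nat where n: "\<forall>j. half j > (of_nat n :: rat) \<longrightarrow> act M (\<psi> j) v = 0"
    using assms(1) part_M unfolding smooth_FV_def by blast
  have "act M (\<psi> j) v = 0" if "j > int n" for j
  proof -
    have "of_int j > (of_nat n :: rat)" using that by (metis of_int_less_iff of_int_of_nat_eq)
    then show ?thesis using n by (simp add: half_def)
  qed
  then have "{j. j \<ge> 0 \<and> a j v \<noteq> 0} \<subseteq> {0..int n}" by (force simp: a_def)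
  then have "finite {j. j \<ge> 0 \<and> a j v \<noteq> 0}" by (rule finite_subset) simp
  then obtain i w where "w \<in> Vac_part i" "w \<noteq> 0" using vacuum_vector_exists v by blast
  then show ?thesis using part_whole[of Vac_part i] csubspace_Vac_part by (auto simp: part_V)
qed

section \<open>Simplicity of \<open>V\<close>\<close>

lemma graded_submodule_V: "graded_submodule Vir V Vac_part"
  using act_V_V csubspace_Vac_part by (simp add: graded_submodule_def part_V)

text \<open>The span contains \<open>v = B vac v\<close> for every \<open>v\<close> in
  \<open>whole N\<close>, so it is a nonzero submodule of a simple module.\<close>

lemma B_generates:
  assumes "simple_module FV M" "graded_submodule Vir V N" "whole N \<noteq> {0}"
  shows "cspan {B u v | u v. v \<in> whole N} = mspace M"
proof -
  have zero: "0 \<in> whole N"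
    using assms(2) by (intro complex_vector.subspace_0 csubspace_whole) (simp_all add: graded_submodule_def)
  then obtain v where v: "v \<in> whole N" "v \<noteq> 0" using assms(3) by blast
  have "v = B vac v" by (simp add: B_basis)
  then have "v \<in> cspan {B u v | u v. v \<in> whole N}" using v by (intro complex_vector.span_base) blast
  then show ?thesis
    using assms(1) graded_submodule_span[OF assms(2)] v(2) unfolding simple_module_def by blast
qed

text \<open>A nonzero submodule \<open>N\<close> generates all of \<open>M\<close>, in particular
  every vacuum vector, and \<open>Vac_decomposition\<close> brings these back into
  \<open>N\<close>.\<close>

lemma simple_V:
  assumes "simple_module FV M" "smooth_FV M"
  shows "simple_module Vir V"
  unfolding simple_module_def
proof (intro conjI allI impI)
  show "mspace V \<noteq> {0}" using V_nonzero assms by (simp add: simple_module_def)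
  fix N assume N: "graded_submodule Vir V N"
  have N_part: "csubspace (N i)" "N i \<subseteq> part V i" for i
    using N by (simp_all add: graded_submodule_def)
  then have sub: "whole N \<subseteq> mspace V" by (auto simp: whole_def) blast
  show "whole N = {0} \<or> whole N = mspace V"
  proof (cases "whole N = {0}")
    case False
    have "mspace V \<subseteq> whole N"
    proof
      fix v assume "v \<in> mspace V"
      then have "v \<in> Vac" using mspace_V by blast
      then show "v \<in> whole N"
        using Vac_decomposition[of "whole N" v] sub mspace_V B_generates[OF assms(1) N False]
        by (simp add: csubspace_whole N_part Vac_M subset_trans)
    qed
    then show ?thesis using sub by blast
  qed simp
qed (rule is_module_V)

end

section \<open>The tensor product\<close>

lemma lin_ext_tensor_null:
  assumes left: "\<And>u u' v. f (u + u') v = f u v + f u' v" "\<And>c u v. f (c *\<^sub>C u) v = c *\<^sub>C f u v"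
    and right: "\<And>u v v'. f u (v + v') = f u v + f u v'" "\<And>c u v. f u (c *\<^sub>C v) = c *\<^sub>C f u v"
    and p: "p \<in> tensor_null"
  shows "lin_ext (\<lambda>(u, v). f u v) p = 0"
proof -
  have diff: "lin_ext g (x - y) = lin_ext g x - lin_ext g y" for g :: "'a \<times> 'b \<Rightarrow> 'c" and x y
    using lin_ext_add[of g x "- y"] by (simp add: lin_ext_uminus)
  show ?thesis using p unfolding tensor_null_def
  proof (induction rule: complex_vector.span_induct_alt)
    case (step c x y)
    then have "lin_ext (\<lambda>(u, v). f u v) x = 0"
      by (auto simp: diff left right lin_ext_scaleC)
    then show ?case using step by (simp add: lin_ext_add lin_ext_scaleC)
  qed simp
qed

text \<open>The universal property of the tensor product. It asks for bilinearity on the full types,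
  so maps that are linear only on a subspace are first composed with a projection onto it.\<close>

lemma tensor_lift:
  fixes f :: "'a::complex_vector \<Rightarrow> 'b::complex_vector \<Rightarrow> 'c::complex_vector"
  assumes left: "\<And>u u' v. f (u + u') v = f u v + f u' v" "\<And>c u v. f (c *\<^sub>C u) v = c *\<^sub>C f u v"
    and right: "\<And>u v v'. f u (v + v') = f u v + f u v'" "\<And>c u v. f u (c *\<^sub>C v) = c *\<^sub>C f u v"
  obtains T where "clinear T" "\<And>u v. T (u \<otimes> v) = f u v"
proof -
  let ?g = "lin_ext (\<lambda>(u, v). f u v)"
  define T where "T t = ?g (rep_tensor t)" for t
  have abs: "T (abs_tensor p) = ?g p" for p
  proof -
    have "tensor_rel (rep_tensor (abs_tensor p)) p"
      using Quotient3_rep_abs[OF Quotient3_tensor] by simp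
    then have "?g (rep_tensor (abs_tensor p) - p) = 0"
      using lin_ext_tensor_null[of f, OF left right] by (simp add: tensor_rel_def)
    then show ?thesis
      using lin_ext_add[of "\<lambda>(u, v). f u v" "rep_tensor (abs_tensor p) - p" p] by (simp add: T_def)
  qed
  have "clinear T"
  proof (rule clinearI)
    fix x y :: "('a, 'b) tensor" and c
    obtain p q where pq: "x = abs_tensor p" "y = abs_tensor q"
      using Quotient3_abs_rep[OF Quotient3_tensor] by metis
    show "T (x + y) = T x + T y" by (simp add: pq plus_tensor.abs_eq abs lin_ext_add)
    show "T (c *\<^sub>C x) = c *\<^sub>C T x" by (simp add: pq scaleC_tensor.abs_eq abs lin_ext_scaleC)
  qed
  moreover have "T (u \<otimes> v) = f u v" for u v by (simp add: tensor_of.abs_eq abs)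
  ultimately show ?thesis using that by blast
qed

lemma tensor_of_add_left: "(u + u') \<otimes> v = u \<otimes> v + u' \<otimes> v"
  by (transfer, unfold tensor_rel_def tensor_null_def diff_diff_eq[symmetric],
    rule complex_vector.span_base, blast)

lemma tensor_of_add_right: "u \<otimes> (v + v') = u \<otimes> v + u \<otimes> v'"
  by (transfer, unfold tensor_rel_def tensor_null_def diff_diff_eq[symmetric],
    rule complex_vector.span_base, blast)

lemma tensor_of_scaleC_left: "(c *\<^sub>C u) \<otimes> v = c *\<^sub>C (u \<otimes> v)"
  by (transfer, unfold tensor_rel_def tensor_null_def diff_diff_eq[symmetric],
    rule complex_vector.span_base, blast)

lemma tensor_of_scaleC_right: "u \<otimes> (c *\<^sub>C v) = c *\<^sub>C (u \<otimes> v)"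
  by (transfer, unfold tensor_rel_def tensor_null_def diff_diff_eq[symmetric],
    rule complex_vector.span_base, blast)

lemmas tensor_of_linear =
  tensor_of_add_left tensor_of_add_right tensor_of_scaleC_left tensor_of_scaleC_right

lemma bilinear_on_tensor: "bilinear_on X (\<otimes>)"
  unfolding bilinear_on_def by (auto intro!: clinearI simp: clinear_on_def tensor_of_linear)

lemma tensor_of_0_right [simp]: "u \<otimes> 0 = 0"
  using tensor_of_scaleC_right[of u 0 0] by simp

lemma linear_projection:
  fixes X :: "'a::complex_vector set"
  assumes "csubspace X"
  obtains p where "clinear p" "\<And>v. p v \<in> X" "\<And>v. v \<in> X \<Longrightarrow> p v = v"
proof -
  interpret vector_space_pair "scaleC :: complex \<Rightarrow> 'a \<Rightarrow> 'a" "scaleC :: complex \<Rightarrow> 'a \<Rightarrow> 'a" ..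
  obtain E where E: "\<not> complex_vector.dependent E" "cspan E = X"
    using complex_vector.basis_exists[of X] complex_vector.span_eq_iff assms
      complex_vector.span_minimal by (metis subset_antisym)
  \<comment> \<open>The identity on a basis of \<open>X\<close> is extended linearly with range
    inside the span of that basis.\<close>
  then obtain p where p: "clinear p" "\<forall>x\<in>E. p x = x" "range p = X"
    using linear_independent_extend_subspace[of E id] by auto
  interpret p: Vector_Spaces.linear scaleC scaleC p by fact
  have "p v = v" if "v \<in> X" for v
    using that unfolding E(2)[symmetric]
    by (induction rule: complex_vector.span_induct_alt) (use p(2) in \<open>auto simp: p.add p.scale\<close>)
  then show ?thesis using that p by blast
qed

section \<open>Twist, inflation and the Fock action on generators\<close>

lemma sigma_basis: "sigma m (basis_vec b) = (case b of
     gL k \<Rightarrow> L k | gPsi l \<Rightarrow> m *\<^sub>C \<psi> l | gC \<Rightarrow> \<c> | gZ \<Rightarrow> m\<^sup>2 *\<^sub>C \<z>)"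
  and sigma_linear: "sigma m (x + y) = sigma m x + sigma m y" "sigma m (c *\<^sub>C x) = c *\<^sub>C sigma m x"
    "sigma m 0 = 0"
  by (simp_all add: sigma_def lin_ext_add lin_ext_scaleC)

lemma vir_proj_basis: "vir_proj (basis_vec b) =
     (case b of gL k \<Rightarrow> L k | gPsi l \<Rightarrow> 0 | gC \<Rightarrow> \<c> | gZ \<Rightarrow> 0)"
  and vir_proj_linear: "vir_proj (x + y) = vir_proj x + vir_proj y" "vir_proj (c *\<^sub>C x) = c *\<^sub>C vir_proj x"
    "vir_proj 0 = 0"
  by (simp_all add: vir_proj_def lin_ext_add lin_ext_scaleC)

text \<open>Odd elements act as 0 on an inflated module, so the term of the tensor action that
  carries the Koszul sign vanishes.\<close>

lemma vir_proj_odd: "x \<in> fv_part 1 \<Longrightarrow> vir_proj x = 0"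
proof (induction rule: complex_vector.span_induct_alt)
  case (step c x y)
  then obtain b where "x = basis_vec b" "fv_parity b = 1" by blast
  then have "vir_proj x = 0" by (cases b) (simp_all add: vir_proj_basis)
  then show ?case using step by (simp add: vir_proj_linear)
qed (simp add: vir_proj_linear)

lemma act_Fock_basis: "act Fock (basis_vec b) u = (case b of
       gL k \<Rightarrow> L_op k u | gPsi n \<Rightarrow> psi_op n u | gC \<Rightarrow> (1 / 2) *\<^sub>C u | gZ \<Rightarrow> u)"
  and act_Fock_linear_left: "act Fock (x + y) u = act Fock x u + act Fock y u"
    "act Fock (c *\<^sub>C x) u = c *\<^sub>C act Fock x u" "act Fock 0 u = 0"
  by (simp_all add: Fock_def lin_ext_add lin_ext_scaleC)

lemma act_Fock_add: "act Fock x (u + v) = act Fock x u + act Fock x v"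
proof (induction x rule: ext_induct)
  case (basis b)
  then show ?case
    by (cases b) (simp_all add: act_Fock_basis L_op_add psi_op_add complex_vector.scale_right_distrib)
qed (simp_all add: act_Fock_linear_left complex_vector.scale_right_distrib)

lemma act_Fock_scaleC: "act Fock x (c *\<^sub>C u) = c *\<^sub>C act Fock x u"
proof (induction x rule: ext_induct)
  case (basis b)
  then show ?case
    by (cases b) (simp_all add: act_Fock_basis L_op_scaleC psi_op_scaleC)
qed (simp_all add: act_Fock_linear_left complex_vector.scale_right_distrib mult.commute)

section \<open>The isomorphism with the tensor product\<close>

context level_module
begin

abbreviation Ten :: "(fv, (ext, 'm) tensor) supermodule" where
  "Ten \<equiv> tensor_module FV (twist \<mu> Fock) (inflate V)"

lemma part_Ten: "part Ten = (\<lambda>k. cspan {u \<otimes> v | u v i j. u \<in> ext_part i \<and> v \<in> Vac_part j \<and> i + j = k})"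
  by (rule ext) (simp add: tensor_module_def tensor_part_def twist_def inflate_def Fock_def part_V)

lemma mspace_Ten: "mspace Ten = cspan {u \<otimes> v | u v. v \<in> mspace V}"
  unfolding part_Ten part_V by (intro span_bilinear_graded csubspace_Vac_part bilinear_on_tensor)

text \<open>\<open>tensor_act\<close> is defined by choice, so an operator meeting its specification
  has to be exhibited before the formula can be used.\<close>

lemma act_Ten:
  shows "clinear (act Ten x)"
    and "v \<in> mspace V \<Longrightarrow> act Ten x (u \<otimes> v) = act Fock (sigma \<mu> x) u \<otimes> v + u \<otimes> act V (vir_proj x) v"
proof -
  obtain p where p: "clinear p" "\<And>v. p v \<in> mspace V" "\<And>v. v \<in> mspace V \<Longrightarrow> p v = v"
    using linear_projection[OF csubspace_V] by blast
  interpret p: Vector_Spaces.linear scaleC scaleC p by (rule p(1))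
  have pVac: "p v \<in> Vac" for v using p(2) mspace_V by blast
  \<comment> \<open>The projection \<open>p\<close> extends the action of \<open>V\<close> to the
    full type, as \<open>tensor_lift\<close> requires, without changing it on
    \<open>mspace V\<close>.\<close>
  obtain T where T: "clinear T" "\<And>u v. T (u \<otimes> v) =
      act Fock (sigma \<mu> x) u \<otimes> v + u \<otimes> act V (vir_proj x) (p v)"
    by (rule tensor_lift[of "\<lambda>u v. act Fock (sigma \<mu> x) u \<otimes> v + u \<otimes> act V (vir_proj x) (p v)"])
      (auto simp: act_Fock_add act_Fock_scaleC tensor_of_linear p.add p.scale act_V_add act_V_scaleC pVac
        complex_vector.scale_right_distrib)
  let ?spec = "\<lambda>T. clinear T \<and>
     (\<forall>x0\<in>gpart FV 0. \<forall>x1\<in>gpart FV 1. x = x0 + x1 \<longrightarrow>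
       (\<forall>j. \<forall>u\<in>part (twist \<mu> Fock) j. \<forall>v\<in>mspace (inflate V).
          T (u \<otimes> v) = act (twist \<mu> Fock) x u \<otimes> v + u \<otimes> act (inflate V) x0 v
            + koszul 1 j *\<^sub>C (u \<otimes> act (inflate V) x1 v)))"
  have "?spec T"
    using T p by (auto simp: FV_def twist_def inflate_def vir_proj_linear vir_proj_odd)
  then have spec: "?spec (act Ten x)"
    unfolding tensor_module_def tensor_act_def supermodule.simps by (rule someI[of ?spec])
  then show lin: "clinear (act Ten x)" by blast
  interpret lin: Vector_Spaces.linear scaleC scaleC "act Ten x" by (rule lin)
  assume v: "v \<in> mspace V"
  obtain x0 x1 where x: "x = x0 + x1" "x0 \<in> fv_part 0" "x1 \<in> fv_part 1"
    using whole_fv unfolding whole_def by blast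
  \<comment> \<open>The specification speaks of homogeneous \<open>u\<close> only; a general
    \<open>u\<close> is split into components afterwards.\<close>
  have homogeneous: "act Ten x (u \<otimes> v) = act Fock (sigma \<mu> x) u \<otimes> v + u \<otimes> act V (vir_proj x) v"
    if "u \<in> ext_part j" for u j
  proof -
    have "act Ten x (u \<otimes> v) = act (twist \<mu> Fock) x u \<otimes> v + u \<otimes> act (inflate V) x0 v
        + koszul 1 j *\<^sub>C (u \<otimes> act (inflate V) x1 v)"
      using spec x that v by (simp add: FV_def twist_def inflate_def Fock_def)
    then show ?thesis using x by (simp add: twist_def inflate_def vir_proj_linear vir_proj_odd)
  qed
  obtain u0 u1 where u: "u = u0 + u1" "u0 \<in> ext_part 0" "u1 \<in> ext_part 1"
    using whole_ext_part unfolding whole_def by blast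
  show "act Ten x (u \<otimes> v) = act Fock (sigma \<mu> x) u \<otimes> v + u \<otimes> act V (vir_proj x) v"
    using homogeneous[OF u(2)] homogeneous[OF u(3)]
    by (simp add: u(1) tensor_of_linear lin.add act_Fock_add)
qed

text \<open>The Leibniz rule, checked on generators. The factor \<open>\<mu>\<close> divided out in
  \<open>a\<close> is restored by \<open>sigma\<close>, which also gives \<open>\<z>\<close> its
  level.\<close>

lemma act_B:
  assumes v: "v \<in> mspace V"
  shows "act M x (B u v) = B (act Fock (sigma \<mu> x) u) v + B u (act V (vir_proj x) v)"
proof -
  have vVac: "v \<in> Vac" "act V y v \<in> mspace M" for y using act_V_V[OF v] v mspace_V Vac_M by blast+
  then have M: "B w v \<in> mspace M" "v \<in> mspace M" for w by (simp_all add: B_M Vac_M)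
  have zero: "B u 0 = 0" using B_scaleC[OF M(2), of u 0] by simp
  show ?thesis
  proof (induction x rule: ext_induct)
    case (basis b)
    show ?case
    proof (cases b)
      case (gL k)
      then show ?thesis
        by (simp add: sigma_basis vir_proj_basis act_Fock_basis act_V_basis act_L_B vVac(1))
    next
      case (gPsi n)
      have "act M (\<psi> n) (B u v) = \<mu> *\<^sub>C a n (B u v)" using mu by (simp add: a_def)
      then show ?thesis
        by (simp add: gPsi sigma_basis vir_proj_basis act_Fock_basis act_Fock_linear_left a_B vVac(1)
            B_scaleC_left zero)
    next
      case gC
      \<comment> \<open>The central charge splits into 1/2 on the Fock factor and the rest on
        \<open>V\<close>.\<close>
      have "B u (act M \<c> v - (1 / 2) *\<^sub>C v) = B u (act M \<c> v) - (1 / 2) *\<^sub>C B u v"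
        using B_add[of "act M \<c> v" "- (1 / 2) *\<^sub>C v" u] B_scaleC[OF M(2), of u "- (1 / 2)"] M(2)
        by (simp add: act_M_basis complex_vector.subspace_scale[OF csubspace_M] complex_vector.subspace_neg[OF csubspace_M])
      then show ?thesis
        by (simp add: gC sigma_basis vir_proj_basis act_Fock_basis act_V_basis act_c_B M(2) B_scaleC_left)
    next
      case gZ
      then show ?thesis using level M(1)
        by (simp add: has_level_def sigma_basis vir_proj_basis act_Fock_basis act_Fock_linear_left
            B_scaleC_left zero)
    qed
  qed (simp_all add: M act_0_left act_add_left act_scaleC_left sigma_linear vir_proj_linear
      act_Fock_linear_left act_V_add_left act_V_scaleC_left zero B_add_left B_scaleC_left
      B_add B_scaleC vVac complex_vector.subspace_scale[OF csubspace_M] complex_vector.scale_right_distrib)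
qed

text \<open>The universal property yields maps out of the tensor product, so \<open>B\<close>
  induces \<open>\<Phi>\<close> towards \<open>M\<close> and the required isomorphism is its
  inverse.\<close>

lemma isomorphic_Ten:
  assumes "simple_module FV M" "smooth_FV M"
  shows "isomorphic FV M Ten"
proof -
  obtain p where p: "clinear p" "\<And>v. p v \<in> mspace V" "\<And>v. v \<in> mspace V \<Longrightarrow> p v = v"
    using linear_projection[OF csubspace_V] by blast
  interpret p: Vector_Spaces.linear scaleC scaleC p by (rule p(1))
  have pM: "p v \<in> mspace M" for v using p(2) mspace_V Vac_M by blast
  obtain \<Phi> where \<Phi>: "clinear \<Phi>" "\<And>u v. \<Phi> (u \<otimes> v) = B u (p v)"
    by (rule tensor_lift[of "\<lambda>u v. B u (p v)"])
      (auto simp: B_add_left B_scaleC_left p.add p.scale B_add B_scaleC pM)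
  interpret \<Phi>: Vector_Spaces.linear scaleC scaleC \<Phi> by (rule \<Phi>(1))
  have \<Phi>_B: "\<Phi> (u \<otimes> v) = B u v" if "v \<in> mspace V" for u v using that \<Phi>(2) p(3) by simp
  have sub_Ten: "csubspace (mspace Ten)" unfolding mspace_Ten by (rule complex_vector.subspace_span)
  have Vac_part_V: "Vac_part j \<subseteq> mspace V" for j
    using part_whole[of Vac_part j] csubspace_Vac_part by (simp add: part_V)
  have image_part: "\<Phi> ` part Ten k = cspan {B u v | u v i j. u \<in> ext_part i \<and> v \<in> Vac_part j \<and> i + j = k}" for k
  proof -
    have "\<Phi> ` {u \<otimes> v | u v i j. u \<in> ext_part i \<and> v \<in> Vac_part j \<and> i + j = k} =
      {B u v | u v i j. u \<in> ext_part i \<and> v \<in> Vac_part j \<and> i + j = k}"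
      using \<Phi>_B Vac_part_V by (auto simp: image_iff subset_iff) (metis+)
    then show ?thesis unfolding part_Ten by (simp only: \<Phi>.span_image[symmetric])
  qed
  have generates: "cspan {B u v | u v. v \<in> mspace V} = mspace M"
    using B_generates[OF assms(1) graded_submodule_V] V_nonzero[OF assms(2)] assms(1)
    by (simp add: part_V simple_module_def)
  \<comment> \<open>The images of the graded parts lie in the parts of \<open>M\<close> and together
    exhaust \<open>M\<close> by simplicity, which forces equality in each degree.\<close>
  have image_part_M: "\<Phi> ` part Ten k = part M k" for k
    unfolding image_part
  proof (rule graded_part_eq[OF superspace, where Q = "\<lambda>k. cspan {B u v | u v i j. u \<in> ext_part i \<and> v \<in> Vac_part j \<and> i + j = k}"])
    show "whole (\<lambda>k. cspan {B u v | u v i j. u \<in> ext_part i \<and> v \<in> Vac_part j \<and> i + j = k}) = mspace M"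
      using graded_submodule_span(2)[OF graded_submodule_V] generates by (simp add: part_V)
  qed (use graded_submodule_span(1)[OF graded_submodule_V] in \<open>simp_all add: graded_submodule_def\<close>)
  have part_Ten_sub: "part Ten k \<subseteq> mspace Ten" for k
    by (rule part_whole) (simp_all add: part_Ten complex_vector.subspace_span)
  have image: "\<Phi> ` mspace Ten = mspace M"
  proof -
    have "\<Phi> ` {u \<otimes> v | u v. v \<in> mspace V} = {B u v | u v. v \<in> mspace V}"
      using \<Phi>_B by (auto simp: image_iff) (metis+)
    then show ?thesis unfolding mspace_Ten generates[symmetric] by (simp only: \<Phi>.span_image[symmetric])
  qed
  \<comment> \<open>An element of the tensor product expands over basis monomials with second
    factors in \<open>V\<close>. Its image is the matching sum of creation monomials, to which
    independence applies.\<close>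
  have kernel: "t = 0" if t: "t \<in> mspace Ten" "\<Phi> t = 0" for t
  proof -
    obtain f F where F: "finite F" "\<And>S. f S \<in> mspace V" "\<And>S. S \<notin> F \<Longrightarrow> f S = 0"
      "t = (\<Sum>S\<in>F. basis_vec S \<otimes> f S)"
      using span_bilinear_decomposition[OF csubspace_V bilinear_on_tensor] t(1) unfolding mspace_Ten by blast
    have sum0: "(\<Sum>S\<in>F. monomial S (f S)) = 0"
      using t(2) by (simp add: F(4) \<Phi>.sum \<Phi>_B F(2) B_basis)
    have "f S \<in> Vac" for S using F(2) mspace_V by blast
    then have "f S = 0" for S by (rule monomial_independent[OF F(1) _ F(3) sum0])
    then show ?thesis by (simp add: F(4))
  qed
  have inj: "inj_on \<Phi> (mspace Ten)"
  proof (rule inj_onI)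
    fix s t assume "s \<in> mspace Ten" "t \<in> mspace Ten" "\<Phi> s = \<Phi> t"
    then show "s = t"
      using kernel[of "s - t"] complex_vector.subspace_diff[OF sub_Ten] by (simp add: \<Phi>.diff)
  qed
  have bij: "bij_betw \<Phi> (mspace Ten) (mspace M)" using inj image by (simp add: bij_betw_def)
  define \<phi> where "\<phi> = inv_into (mspace Ten) \<Phi>"
  have \<phi>: "\<phi> (\<Phi> t) = t" if "t \<in> mspace Ten" for t using that inj by (simp add: \<phi>_def)
  have act: "act Ten x t \<in> mspace Ten \<and> \<Phi> (act Ten x t) = act M x (\<Phi> t)" if "t \<in> mspace Ten" for x t
  proof -
    interpret T: Vector_Spaces.linear scaleC scaleC "act Ten x" by (rule act_Ten)
    \<comment> \<open>The last conjunct strengthens the induction, since the action on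
      \<open>M\<close> is known to be additive only on \<open>mspace M\<close>.\<close>
    have "act Ten x t \<in> mspace Ten \<and> \<Phi> (act Ten x t) = act M x (\<Phi> t) \<and> \<Phi> t \<in> mspace M"
      using that unfolding mspace_Ten
    proof (induction rule: complex_vector.span_induct_alt)
      case base
      then show ?case
        by (simp add: T.zero \<Phi>.zero act_0 complex_vector.span_zero complex_vector.subspace_0[OF csubspace_M])
    next
      case (step c s t)
      then obtain u v where s: "s = u \<otimes> v" "v \<in> mspace V" by blast
      have span: "u \<otimes> v \<in> cspan {u \<otimes> v | u v. v \<in> mspace V}" if "v \<in> mspace V" for u v
        using that by (intro complex_vector.span_base) blast
      have "act Ten x s \<in> cspan {u \<otimes> v | u v. v \<in> mspace V}" "\<Phi> (act Ten x s) = act M x (\<Phi> s)"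
        unfolding s(1) act_Ten(2)[OF s(2)]
        by (simp_all add: \<Phi>.add \<Phi>_B act_B s(2) act_V_V complex_vector.span_add span)
      moreover have "\<Phi> s \<in> mspace M" using s mspace_V by (auto simp: \<Phi>_B B_M Vac_M)
      ultimately show ?case using step.IH
        by (simp add: T.add T.scale \<Phi>.add \<Phi>.scale act_add act_scaleC complex_vector.span_add
            complex_vector.span_scale complex_vector.subspace_add[OF csubspace_M]
            complex_vector.subspace_scale[OF csubspace_M])
    qed
    then show ?thesis by blast
  qed
  show ?thesis unfolding isomorphic_def
  proof (intro exI[of _ \<phi>] conjI ballI allI)
    show "bij_betw \<phi> (mspace M) (mspace Ten)" unfolding \<phi>_def using bij by (rule bij_betw_inv_into)
    show "clinear_on (mspace M) \<phi>" unfolding clinear_on_def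
    proof (intro conjI ballI allI)
      fix v w c assume v: "v \<in> mspace M" and w: "w \<in> mspace M"
      obtain s t where st: "s \<in> mspace Ten" "t \<in> mspace Ten" "v = \<Phi> s" "w = \<Phi> t"
        using v w unfolding image[symmetric] by blast
      show "\<phi> (v + w) = \<phi> v + \<phi> w"
        using st \<phi>[of "s + t"] complex_vector.subspace_add[OF sub_Ten] by (simp add: \<phi> \<Phi>.add)
    next
      fix v c assume v: "v \<in> mspace M"
      obtain s where st: "s \<in> mspace Ten" "v = \<Phi> s" using v unfolding image[symmetric] by blast
      show "\<phi> (c *\<^sub>C v) = c *\<^sub>C \<phi> v"
        using st \<phi>[of "c *\<^sub>C s"] complex_vector.subspace_scale[OF sub_Ten] by (simp add: \<phi> \<Phi>.scale)
    qed
    show "\<phi> ` part M i \<subseteq> part Ten i" for i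
      unfolding image_part_M[symmetric] using \<phi> part_Ten_sub by (auto simp: subset_iff)
    fix x v assume "v \<in> mspace M"
    then obtain t where t: "t \<in> mspace Ten" "v = \<Phi> t" unfolding image[symmetric] by blast
    then show "\<phi> (act M x v) = act Ten x (\<phi> v)"
      using act[of t x] \<phi>[of "act Ten x t"] by (simp add: \<phi>)
  qed
qed

end

theorem theorem4p4:
  fixes M :: "(fv, 'm::complex_vector) supermodule" and lam :: complex
  assumes "lam \<noteq> 0"
    and "simple_module FV M"
    and "smooth_FV M"
    and "has_level M lam"
  shows "\<exists>(V :: (fv, 'm) supermodule) \<mu>.
           simple_module Vir V \<and> smooth_Vir V \<and> \<mu>\<^sup>2 = lam \<and>
           isomorphic FV M (tensor_module FV (twist \<mu> Fock) (inflate V))"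
proof -
  have root: "(csqrt lam)\<^sup>2 = lam" by simp
  \<comment> \<open>\<open>csqrt lam\<close> is the chosen square root of the level; it is nonzero
    because \<open>lam\<close> is.\<close>
  interpret level_module M "csqrt lam"
    by unfold_locales (use assms in \<open>simp_all add: simple_module_def\<close>)
  show ?thesis
    using simple_V[OF assms(2,3)] smooth_V[OF assms(3)] root isomorphic_Ten[OF assms(2,3)] by blast
qed

end
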